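(* Let $\omega$ be a non-negative measure on $\mathbb{R}$ with bounded, compactly supported density and total mass $m=\omega(\mathbb{R})>0$. Assume that either $2\ge q_a>q_r=1$, or that $q_a=q_r=1$ and $m\ge1$. Let $\mu^\star$ be the unique steady state, i.e. $\mu^\star=\frac12(\psi_a''\ast\omega)\mathbf{1}_{[\underline x,\overline x]}$ where $\underline x<\overline x$ are real numbers with $(\psi_a'\ast\omega)(\underline x)=-1$ and $(\psi_a'\ast\omega)(\overline x)=1$, and let $\mu:[0,\infty)\to\mathcal{P}(\mathbb{R})$ be a transient solution. Then $W_2(\mu(t),\mu^\star)$ converges to zero monotonically as $t\to\infty$.
   Context: $W_2$ is the $L^2$-Wasserstein distance on $\mathbb{R}$. $L^\infty_c(\mathbb{R})$ denotes essentially bounded functions with compact support; $\mathcal{P}(\mathbb{R})$ the probability measures on $\mathbb{R}$; $\mathcal{P}_2(\mathbb{R})$ those with finite second moment. Absolutely continuous measures are identified with their densities. For a finite non-negative measure $\nu$ on $\mathbb{R}$ let $F_\nu(x)=\nu((-\infty,x])$ be its CDF and $X_\nu:[0,\nu(\mathbb{R}))\to\mathbb{R}$, $X_\nu(z)=\inf\{x\in\mathbb{R}:F_\nu(x)>z\}$ its pseudo-inverse. $\mathrm{D}([a,b))$ is the Banach space of bounded functions $[a,b)\to\mathbb{R}$ that are right continuous with a left limit at every point, with the sup-norm. Let $q_a,q_r\in[1,2]$, $\psi_a(x)=|x|^{q_a}$, $\psi_r(x)=|x|^{q_r}$, and put $G=F_\omega$, $Y=X_\omega$. For $q_a=1$: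 $\psi_a'=\operatorname{sgn}$, $\psi_a'\ast\omega=2G-m$, and $\psi_a''=2\delta_0$, so $\frac12\psi_a''\ast\omega=\omega$. For $q_a>1$: $\psi_a''(x)=q_a(q_a-1)|x|^{q_a-2}$. Steady state: a probability measure $\mu^\star$ with density in $L^\infty_c(\mathbb{R})$ whose pseudo-inverse $X^\star=X_{\mu^\star}$ satisfies $A(z)=R(z)$ at every $z\in[0,1)$, where $A(z)=\int_0^m\psi_a'(X^\star(z)-Y(\zeta))\,d\zeta$ if $q_a>1$ and $A(z)=2G(X^\star(z))-m$ if $q_a=1$; and $R(z)=\int_0^1\psi_r'(X^\star(z)-X^\star(\zeta))\,d\zeta$ if $q_r>1$ and $R(z)=2z-1$ if $q_r=1$. Under the hypotheses of the claim there is exactly one steady state, and it is given by the formula in the claim (for any admissible choice of $\underline x,\overline x$). Transient solution: a map $\mu:[0,\infty)\to\mathcal{P}_2(\mathbb{R})$ such that (i) $\mu(t)$ has a density in $L^\infty_c(\mathbb{R})$ for every $t\ge0$; (ii) $t\mapsto X_{\mu(t)}$ is continuously differentiable from $[0,\infty)$ into $\mathrm{D}([0,1))$; (iii) for every $t\ge0$ and $z\in[0,1)$, $$\partial_tX_{\mu(t)}(z)=-A(t,z)+R(t,z),$$ where $A(t,z)=\int_0^m\psi_a'(X_{\mu(t)}(z)-Y(\zeta))\,d\zeta$ if $q_a>1$ and $A(t,z)=2G(X_{\mu(t)}(z))-m$ if $q_a=1$; and $R(t,z)=\int_0^1\psi_r'(X_{\mu(t)}(z)-X_{\mu(t)}(\zeta))\,d\zeta$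 if $q_r>1$ and $R(t,z)=2z-1$ if $q_r=1$. *)

theory Defs
  imports "HOL-Probability.Probability"
begin

section \<open>Measures, pseudo-inverses and the Wasserstein distance on the real line\<close>

definition Linf_c :: "(real \<Rightarrow> real) set" where
  "Linf_c = {f \<in> borel_measurable borel.
     (\<exists>C. AE x in lborel. \<bar>f x\<bar> \<le> C) \<and> (\<exists>K. compact K \<and> (AE x in lborel. x \<notin> K \<longrightarrow> f x = 0))}"

definition has_Linf_c_density :: "real measure \<Rightarrow> bool" where
  "has_Linf_c_density \<nu> \<longleftrightarrow>
     (\<exists>f \<in> Linf_c. (AE x in lborel. 0 \<le> f x) \<and> \<nu> = density lborel (\<lambda>x. ennreal (f x)))"

definition P2 :: "real measure set" where
  "P2 = {\<nu>. real_distribution \<nu> \<and> integrable \<nu> (\<lambda>x. x\<^sup>2)}"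

text \<open>Only the values for \<open>0 \<le> z < \<nu>(\<real>)\<close> are meaningful. For the compactly supported measures
  considered below the infimum is then over a nonempty set that is bounded below, also for
  \<open>z = 0\<close>.\<close>

definition pseudo_inverse :: "real measure \<Rightarrow> real \<Rightarrow> real" where
  "pseudo_inverse \<nu> z = Inf {x. cdf \<nu> x > z}"

definition couplings :: "real measure \<Rightarrow> real measure \<Rightarrow> (real \<times> real) measure set" where
  "couplings \<mu> \<nu> = {\<pi>. sets \<pi> = sets (borel \<Otimes>\<^sub>M borel) \<and>
      distr \<pi> borel fst = \<mu> \<and> distr \<pi> borel snd = \<nu>}"

text \<open>For members of \<open>P2\<close> the infimum is finite, so that \<open>enn2real\<close> loses nothing.\<close>

definition W2 :: "real measure \<Rightarrow> real measure \<Rightarrow> real" where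
  "W2 \<mu> \<nu> = sqrt (enn2real
     (INF \<pi> \<in> couplings \<mu> \<nu>. \<integral>\<^sup>+ p. ennreal ((fst p - snd p)\<^sup>2) \<partial>\<pi>))"

section \<open>Continuously differentiable curves in the space of cadlag functions\<close>

text \<open>Functions on \<open>[a,b)\<close> are represented by total functions; only their restriction to
  \<open>[a,b)\<close> matters.\<close>

definition cadlag_on :: "real \<Rightarrow> real \<Rightarrow> (real \<Rightarrow> real) set" where
  "cadlag_on a b = {f. bounded (f ` {a..<b}) \<and>
     (\<forall>z\<in>{a..<b}. (f \<longlongrightarrow> f z) (at_right z)) \<and>
     (\<forall>z\<in>{a<..<b}. \<exists>l. (f \<longlongrightarrow> l) (at_left z))}"

text \<open>\<open>t \<mapsto> X t\<close> is continuously differentiable from \<open>[0,\<infinity>)\<close> (one-sided at \<open>0\<close>) into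
  the cadlag functions on \<open>[a,b)\<close>. Convergence in the sup-norm is uniform convergence on
  \<open>[a,b)\<close>, and \<open>V\<close> is the derivative.\<close>

definition C1_cadlag :: "real \<Rightarrow> real \<Rightarrow> (real \<Rightarrow> real \<Rightarrow> real) \<Rightarrow> bool" where
  "C1_cadlag a b X \<longleftrightarrow> (\<forall>t\<ge>0. X t \<in> cadlag_on a b) \<and>
     (\<exists>V. (\<forall>t\<ge>0. V t \<in> cadlag_on a b) \<and>
       (\<forall>t\<ge>0. uniform_limit {a..<b} (\<lambda>s z. (X s z - X t z) / (s - t)) (V t) (at t within {0..})) \<and>
       (\<forall>t\<ge>0. uniform_limit {a..<b} V (V t) (at t within {0..})))"

section \<open>Power-law kernels\<close>

definition psi :: "real \<Rightarrow> real \<Rightarrow> real" where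
  "psi q x = \<bar>x\<bar> powr q"

definition dpsi :: "real \<Rightarrow> real \<Rightarrow> real" where
  "dpsi q x = (if q = 1 then sgn x else deriv (psi q) x)"

text \<open>The second derivative for \<open>q > 1\<close>. Its value at \<open>x = 0\<close> (here \<open>0\<close>) is irrelevant,
  since it is only integrated against measures without atoms.\<close>

definition ddpsi :: "real \<Rightarrow> real \<Rightarrow> real" where
  "ddpsi q x = q * (q - 1) * \<bar>x\<bar> powr (q - 2)"

definition conv_with :: "(real \<Rightarrow> real) \<Rightarrow> real measure \<Rightarrow> real \<Rightarrow> real" where
  "conv_with f \<omega> x = (\<integral>y. f (x - y) \<partial>\<omega>)"

text \<open>The measure \<open>1/2 (\<psi>'' * \<omega>)\<close>; for \<open>q = 1\<close> one has \<open>\<psi>'' = 2 \<delta>\<^sub>0\<close> and the convolution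
  is \<open>2 \<omega>\<close>.\<close>

definition half_ddpsi_conv :: "real \<Rightarrow> real measure \<Rightarrow> real measure" where
  "half_ddpsi_conv q \<omega> = (if q = 1 then \<omega>
     else density lborel (\<lambda>x. ennreal (1/2 * conv_with (ddpsi q) \<omega> x)))"

section \<open>Steady states and transient solutions\<close>

definition attraction :: "real \<Rightarrow> real measure \<Rightarrow> (real \<Rightarrow> real) \<Rightarrow> real \<Rightarrow> real" where
  "attraction q \<omega> X z =
     (let m = measure \<omega> UNIV in
      if q = 1 then 2 * cdf \<omega> (X z) - m
      else (LINT \<zeta>:{0..<m}|lborel. dpsi q (X z - pseudo_inverse \<omega> \<zeta>)))"

definition repulsion :: "real \<Rightarrow> (real \<Rightarrow> real) \<Rightarrow> real \<Rightarrow> real" where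
  "repulsion q X z =
     (if q = 1 then 2 * z - 1
      else (LINT \<zeta>:{0..<1}|lborel. dpsi q (X z - X \<zeta>)))"

definition steady_state :: "real \<Rightarrow> real \<Rightarrow> real measure \<Rightarrow> real measure \<Rightarrow> bool" where
  "steady_state qa qr \<omega> \<nu> \<longleftrightarrow> real_distribution \<nu> \<and> has_Linf_c_density \<nu> \<and>
     (\<forall>z\<in>{0..<1}. attraction qa \<omega> (pseudo_inverse \<nu>) z = repulsion qr (pseudo_inverse \<nu>) z)"

definition transient_solution ::
    "real \<Rightarrow> real \<Rightarrow> real measure \<Rightarrow> (real \<Rightarrow> real measure) \<Rightarrow> bool" where
  "transient_solution qa qr \<omega> \<mu> \<longleftrightarrow>
     (\<forall>t\<ge>0. \<mu> t \<in> P2 \<and> has_Linf_c_density (\<mu> t)) \<and>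
     C1_cadlag 0 1 (\<lambda>t. pseudo_inverse (\<mu> t)) \<and>
     (\<forall>t\<ge>0. \<forall>z\<in>{0..<1}.
        ((\<lambda>s. pseudo_inverse (\<mu> s) z) has_real_derivative
           - attraction qa \<omega> (pseudo_inverse (\<mu> t)) z + repulsion qr (pseudo_inverse (\<mu> t)) z)
         (at t within {0..}))"

end

theory Submission
  imports Defs
begin

text \<open>Put \<open>H = \<psi>\<^sub>a' * \<omega>\<close>, a monotone Lipschitz function. Substituting \<open>y = Y \<zeta>\<close> turns the attraction term
  into \<open>H (X z)\<close>, so for \<open>q\<^sub>r = 1\<close> each \<open>z\<close> evolves on its own by \<open>\<partial>\<^sub>t X = 2 z - 1 - H X\<close>, and the steady state
  is characterised by \<open>H (X\<^sup>\<star> z) = 2 z - 1\<close>, i.e. by its distribution function \<open>(H + 1) / 2\<close> truncated to \<open>[0, 1]\<close>.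
  Monotonicity of \<open>H\<close> makes \<open>\<bar>X t z - X\<^sup>\<star> z\<bar>\<close> decrease in \<open>t\<close>, to zero whenever the level set
  \<open>{H = 2 z - 1}\<close> is a single point, which fails for countably many \<open>z\<close> only. Since \<open>W2\<close> is the \<open>L\<^sup>2\<close> distance
  of the pseudo-inverses, dominated convergence concludes.\<close>

section \<open>Pseudo-inverses\<close>

context finite_borel_measure
begin

text \<open>Positivity of \<open>z\<close> bounds the superlevel set from below, because the cdf
  tends to 0 at \<open>at_bot\<close>. Without such a bound, \<open>Inf\<close> would be an
  unspecified real.\<close>

lemma pseudo_inverse_le:
  assumes "0 < z" "z < cdf M x"
  shows "pseudo_inverse M z \<le> x"
  unfolding pseudo_inverse_def
proof (rule cInf_lower)
  have "\<forall>\<^sub>F y in at_bot. cdf M y < z"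
    using cdf_lim_at_bot assms by (simp add: order_tendsto_iff)
  then obtain y where y: "cdf M y < z"
    by (auto simp: eventually_at_bot_linorder)
  show "bdd_below {x. z < cdf M x}"
  proof (rule bdd_belowI)
    fix u assume "u \<in> {x. z < cdf M x}"
    then show "y \<le> u" using y cdf_nondecreasing[of u y] by force
  qed
qed (use assms in auto)

text \<open>Here \<open>z\<close> below the total mass keeps the superlevel set nonempty, and every
  point of that set lies to the right of \<open>x\<close> since the cdf is monotone.\<close>

lemma le_pseudo_inverse:
  assumes "z < measure M UNIV" "cdf M x \<le> z"
  shows "x \<le> pseudo_inverse M z"
  unfolding pseudo_inverse_def
proof (rule cInf_greatest)
  have "\<forall>\<^sub>F y in at_top. z < cdf M y"
    using cdf_lim_at_top assms by (simp add: order_tendsto_iff borel_UNIV)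
  then show "{x. z < cdf M x} \<noteq> {}"
    by (auto simp: eventually_at_top_linorder)
next
  fix u assume "u \<in> {x. z < cdf M x}"
  then show "x \<le> u" using assms cdf_nondecreasing[of u x] by force
qed

text \<open>Right continuity does the work: if the cdf were below \<open>z\<close> at
  \<open>x\<close>, it would still be below \<open>z\<close> at some \<open>y > x\<close>, and then
  the pseudo-inverse would be at least \<open>y\<close>.\<close>

lemma le_cdf_of_pseudo_inverse_le:
  assumes "z < measure M UNIV" "pseudo_inverse M z \<le> x"
  shows "z \<le> cdf M x"
proof (rule ccontr)
  assume "\<not> z \<le> cdf M x"
  then have "\<forall>\<^sub>F y in at_right x. cdf M y < z"
    using cdf_is_right_cont[of x] by (auto simp: continuous_within order_tendsto_iff)
  then obtain b where b: "b > x" "\<And>y. x < y \<Longrightarrow> y < b \<Longrightarrow> cdf M y < z"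
    by (auto simp: eventually_at_right_field)
  then obtain y where "x < y" "cdf M y < z" using dense[of x b] by auto
  then show False using le_pseudo_inverse[of z y] assms by auto
qed

lemma mono_on_pseudo_inverse: "mono_on {0<..<measure M UNIV} (pseudo_inverse M)"
proof (intro mono_onI)
  fix r s assume rs: "r \<in> {0<..<measure M UNIV}" "s \<in> {0<..<measure M UNIV}" "r \<le> s"
  show "pseudo_inverse M r \<le> pseudo_inverse M s"
  proof (rule ccontr)
    assume "\<not> ?thesis"
    then obtain x where x: "pseudo_inverse M s < x" "x < pseudo_inverse M r"
      using dense[of "pseudo_inverse M s" "pseudo_inverse M r"] by auto
    have "cdf M x \<le> r" using pseudo_inverse_le[of r x] x rs by force
    with le_pseudo_inverse[of s x] x rs show False by force
  qed
qed

lemma measurable_pseudo_inverse [measurable]: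
  "pseudo_inverse M \<in> borel_measurable (restrict_space borel {0<..<measure M UNIV})"
  by (rule borel_measurable_mono_on_fnc[OF mono_on_pseudo_inverse])

text \<open>Quantile transform: by the three comparisons above, the \<open>z\<close> with
  pseudo-inverse at most \<open>x\<close> form a set between the open interval from 0 to
  \<open>cdf M x\<close> and its closure, hence of length \<open>cdf M x\<close>. It turns integrals
  against \<open>M\<close> into integrals over \<open>z\<close>.\<close>

lemma distr_pseudo_inverse:
  "distr (restrict_space lborel {0<..<measure M UNIV}) borel (pseudo_inverse M) = M"
    (is "distr ?R _ ?X = _")
proof (rule cdf_unique')
  have "finite_measure ?R"
    by (rule finite_measureI) (simp add: emeasure_restrict_space space_restrict_space)
  moreover have meas [measurable]: "?X \<in> borel_measurable ?R"
    using measurable_pseudo_inverse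
    by (simp add: measurable_def space_restrict_space sets_restrict_space)
  ultimately show fin: "finite_borel_measure (distr ?R borel ?X)"
    by (auto simp: finite_borel_measure_def finite_borel_measure_axioms_def
        intro: finite_measure.finite_measure_distr)
  show "finite_borel_measure M" ..
  show "cdf (distr ?R borel ?X) = cdf M"
  proof
    fix x
    let ?S = "{z \<in> {0<..<measure M UNIV}. ?X z \<le> x}"
    have S: "?S = ?X -` {..x} \<inter> space ?R"
      by (auto simp: space_restrict_space)
    have "?S \<in> sets ?R" unfolding S by measurable
    then have Sb: "?S \<in> sets lborel" by (subst (asm) sets_restrict_space_iff) simp_all
    have "cdf (distr ?R borel ?X) x = measure lborel ?S"
    proof -
      have "cdf (distr ?R borel ?X) x = measure ?R ?S"
        unfolding cdf_def S by (rule measure_distr) auto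
      also have "\<dots> = measure lborel ?S"
        by (rule measure_restrict_space) auto
      finally show ?thesis .
    qed
    also have "\<dots> = cdf M x"
    proof (rule antisym)
      have "measure lborel ?S \<le> measure lborel {0..cdf M x}"
      proof (intro measure_mono_fmeasurable Sb)
        show "?S \<subseteq> {0..cdf M x}"
        proof
          fix z assume z: "z \<in> ?S"
          have "z \<le> cdf M x" using z by (intro le_cdf_of_pseudo_inverse_le) auto
          then show "z \<in> {0..cdf M x}" using z by auto
        qed
      qed (simp add: fmeasurable_def emeasure_lborel_Icc_eq)
      then show "measure lborel ?S \<le> cdf M x" using cdf_nonneg by simp
      have "measure lborel {0<..<cdf M x} \<le> measure lborel ?S"
      proof (rule measure_mono_fmeasurable)
        show "{0<..<cdf M x} \<subseteq> ?S"
          using cdf_bounded[of x] by (auto simp: borel_UNIV intro: pseudo_inverse_le)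
        show "?S \<in> fmeasurable lborel"
          by (rule fmeasurableI2[of "{0..measure M UNIV}"]) (use Sb in \<open>auto simp: fmeasurable_def emeasure_lborel_Icc_eq\<close>)
      qed simp
      then show "cdf M x \<le> measure lborel ?S" using cdf_nonneg by simp
    qed
    finally show "cdf (distr ?R borel ?X) x = cdf M x" .
  qed
qed

end

section \<open>The Wasserstein distance on the line\<close>

text \<open>Optimality of the monotone coupling rests on
  \<open>(x - y)\<^sup>2 = 2 \<integral>\<integral>\<^bsub>a < b\<^esub> ([x \<le> a, b < y] + [y \<le> a, b < x]) da db\<close>: every coupling gives the event
  \<open>x \<le> a, b < y\<close> at least the mass \<open>F\<^sub>\<mu> a - F\<^sub>\<nu> b\<close>, and the monotone coupling gives it no more than the
  positive part of this difference.\<close>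

definition straddle :: "real \<Rightarrow> real \<Rightarrow> real \<times> real \<Rightarrow> ennreal" where
  "straddle a b p = indicator {p. fst p \<le> a \<and> a < b \<and> b < snd p} p
                  + indicator {p. snd p \<le> a \<and> a < b \<and> b < fst p} p"

lemma measurable_straddle [measurable]:
  "(\<lambda>((a, b), p). straddle a b p) \<in> borel_measurable ((borel \<Otimes>\<^sub>M borel) \<Otimes>\<^sub>M (borel \<Otimes>\<^sub>M borel))"
proof -
  have "(\<lambda>((a, b), p). straddle a b p) = (\<lambda>q.
      indicator {q. fst (snd q) \<le> fst (fst q) \<and> fst (fst q) < snd (fst q) \<and> snd (fst q) < snd (snd q)} q
    + indicator {q. snd (snd q) \<le> fst (fst q) \<and> fst (fst q) < snd (fst q) \<and> snd (fst q) < fst (snd q)} q)"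
    by (auto simp: straddle_def fun_eq_iff indicator_def)
  then show ?thesis by simp
qed

lemma measurable_straddle' [measurable]:
  assumes [measurable]: "f \<in> borel_measurable N" "g \<in> borel_measurable N" "h \<in> N \<rightarrow>\<^sub>M (borel \<Otimes>\<^sub>M borel)"
  shows "(\<lambda>x. straddle (f x) (g x) (h x)) \<in> borel_measurable N"
  using measurable_compose[of "\<lambda>x. ((f x, g x), h x)" N _ "\<lambda>((a, b), p). straddle a b p",
      OF _ measurable_straddle]
  by simp

text \<open>The pairs \<open>(a, b)\<close> fill a right triangle with both legs
  \<open>y - x\<close>. The inner integral is \<open>y - a\<close>, with antiderivative
  \<open>- (y - a)\<^sup>2 / 2\<close>.\<close>

lemma nn_integral_triangle:
  fixes x y :: real
  assumes "x \<le> y"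
  shows "(\<integral>\<^sup>+a. \<integral>\<^sup>+b. indicator {b. x \<le> a \<and> a < b \<and> b < y} b \<partial>lborel \<partial>lborel) = ennreal ((x - y)\<^sup>2 / 2)"
proof -
  have "(\<integral>\<^sup>+b. indicator {b. x \<le> a \<and> a < b \<and> b < y} b \<partial>lborel) = ennreal (y - a) * indicator {x..y} a" for a
  proof -
    have "(\<integral>\<^sup>+b. indicator {b. x \<le> a \<and> a < b \<and> b < y} b \<partial>lborel)
        = (\<integral>\<^sup>+b. indicator {x..y} a * indicator {a<..<y} b \<partial>lborel)"
      by (intro nn_integral_cong) (auto simp: indicator_def)
    also have "\<dots> = indicator {x..y} a * emeasure lborel {a<..<y}"
      by (subst nn_integral_cmult) auto
    finally show ?thesis by (auto simp: indicator_def)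
  qed
  then have "(\<integral>\<^sup>+a. \<integral>\<^sup>+b. indicator {b. x \<le> a \<and> a < b \<and> b < y} b \<partial>lborel \<partial>lborel)
      = (\<integral>\<^sup>+a. ennreal (y - a) * indicator {x..y} a \<partial>lborel)"
    by simp
  also have "\<dots> = ennreal ((- (y - y)\<^sup>2 / 2) - (- (y - x)\<^sup>2 / 2))"
    using assms
    by (intro nn_integral_FTC_Icc) (auto intro!: derivative_eq_intros simp: field_simps)
  finally show ?thesis by (simp add: power2_commute)
qed

text \<open>According to the order of the two coordinates, one summand of \<open>straddle\<close>
  vanishes and the other is the indicator of a triangle.\<close>

lemma square_dist_eq_straddle:
  "ennreal ((fst p - snd p)\<^sup>2) = 2 * (\<integral>\<^sup>+a. \<integral>\<^sup>+b. straddle a b p \<partial>lborel \<partial>lborel)"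
proof -
  obtain x y where p: "p = (x, y)" by (cases p)
  have half: "2 * ennreal ((x - y)\<^sup>2 / 2) = ennreal ((x - y)\<^sup>2)"
    by (simp add: ennreal_mult'[symmetric] flip: ennreal_numeral)
  show ?thesis
  proof (cases "x \<le> y")
    case True
    have "(\<integral>\<^sup>+a. \<integral>\<^sup>+b. straddle a b p \<partial>lborel \<partial>lborel)
        = (\<integral>\<^sup>+a. \<integral>\<^sup>+b. indicator {b. x \<le> a \<and> a < b \<and> b < y} b \<partial>lborel \<partial>lborel)"
      using True by (intro nn_integral_cong) (auto simp: straddle_def p indicator_def)
    then show ?thesis using nn_integral_triangle[OF True] half by (simp add: p)
  next
    case False
    have "(\<integral>\<^sup>+a. \<integral>\<^sup>+b. straddle a b p \<partial>lborel \<partial>lborel)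
        = (\<integral>\<^sup>+a. \<integral>\<^sup>+b. indicator {b. y \<le> a \<and> a < b \<and> b < x} b \<partial>lborel \<partial>lborel)"
      using False by (intro nn_integral_cong) (auto simp: straddle_def p indicator_def)
    then show ?thesis using nn_integral_triangle[of y x] False half
      by (simp add: p power2_commute)
  qed
qed

text \<open>Two applications of Tonelli. Afterwards couplings can be compared separately for each
  pair \<open>(a, b)\<close>.\<close>

lemma transport_cost_eq_straddle:
  assumes "prob_space \<pi>" and sets [measurable_cong]: "sets \<pi> = sets (borel \<Otimes>\<^sub>M borel)"
  shows "(\<integral>\<^sup>+p. ennreal ((fst p - snd p)\<^sup>2) \<partial>\<pi>)
     = 2 * (\<integral>\<^sup>+a. \<integral>\<^sup>+b. (\<integral>\<^sup>+p. straddle a b p \<partial>\<pi>) \<partial>lborel \<partial>lborel)"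
proof -
  interpret prob_space \<pi> by fact
  interpret pair_sigma_finite lborel \<pi> ..
  have "(\<integral>\<^sup>+p. ennreal ((fst p - snd p)\<^sup>2) \<partial>\<pi>)
      = 2 * (\<integral>\<^sup>+p. \<integral>\<^sup>+a. \<integral>\<^sup>+b. straddle a b p \<partial>lborel \<partial>lborel \<partial>\<pi>)"
    by (simp add: square_dist_eq_straddle nn_integral_cmult)
  also have "(\<integral>\<^sup>+p. \<integral>\<^sup>+a. \<integral>\<^sup>+b. straddle a b p \<partial>lborel \<partial>lborel \<partial>\<pi>)
      = (\<integral>\<^sup>+a. \<integral>\<^sup>+p. \<integral>\<^sup>+b. straddle a b p \<partial>lborel \<partial>\<pi> \<partial>lborel)"
    by (rule Fubini') measurable
  also have "\<dots> = (\<integral>\<^sup>+a. \<integral>\<^sup>+b. \<integral>\<^sup>+p. straddle a b p \<partial>\<pi> \<partial>lborel \<partial>lborel)"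
    by (intro nn_integral_cong Fubini') measurable
  finally show ?thesis .
qed

lemma half_plane_sets [measurable]:
  fixes a b :: real
  shows "{p. fst p \<le> a \<and> b < snd p} \<in> sets (borel \<Otimes>\<^sub>M borel)"
    and "{p. snd p \<le> a \<and> b < fst p} \<in> sets (borel \<Otimes>\<^sub>M borel)"
    and "{p. fst p \<le> a} \<in> sets (borel \<Otimes>\<^sub>M (borel :: real measure))"
    and "{p. snd p \<le> b} \<in> sets ((borel :: real measure) \<Otimes>\<^sub>M borel)"
proof -
  have "{p\<in>space (borel \<Otimes>\<^sub>M borel). fst p \<le> a \<and> b < snd p} \<in> sets (borel \<Otimes>\<^sub>M borel)"
    "{p\<in>space (borel \<Otimes>\<^sub>M borel). snd p \<le> a \<and> b < fst p} \<in> sets (borel \<Otimes>\<^sub>M borel)"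
    "{p\<in>space (borel \<Otimes>\<^sub>M (borel :: real measure)). fst p \<le> a} \<in> sets (borel \<Otimes>\<^sub>M borel)"
    "{p\<in>space ((borel :: real measure) \<Otimes>\<^sub>M borel). snd p \<le> b} \<in> sets (borel \<Otimes>\<^sub>M borel)"
    by measurable
  then show "{p. fst p \<le> a \<and> b < snd p} \<in> sets (borel \<Otimes>\<^sub>M borel)"
    and "{p. snd p \<le> a \<and> b < fst p} \<in> sets (borel \<Otimes>\<^sub>M borel)"
    and "{p. fst p \<le> a} \<in> sets (borel \<Otimes>\<^sub>M (borel :: real measure))"
    and "{p. snd p \<le> b} \<in> sets ((borel :: real measure) \<Otimes>\<^sub>M borel)"
    by (simp_all add: space_pair_measure)
qed

lemma nn_integral_straddle:
  assumes "prob_space \<pi>" and sets [measurable_cong]: "sets \<pi> = sets (borel \<Otimes>\<^sub>M borel)" and "a < b"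
  shows "(\<integral>\<^sup>+p. straddle a b p \<partial>\<pi>) = ennreal (measure \<pi> {p. fst p \<le> a \<and> b < snd p})
        + ennreal (measure \<pi> {p. snd p \<le> a \<and> b < fst p})"
proof -
  interpret prob_space \<pi> by fact
  have "(\<integral>\<^sup>+p. straddle a b p \<partial>\<pi>) = (\<integral>\<^sup>+p. indicator {p. fst p \<le> a \<and> b < snd p} p \<partial>\<pi>)
      + (\<integral>\<^sup>+p. indicator {p. snd p \<le> a \<and> b < fst p} p \<partial>\<pi>)"
    using \<open>a < b\<close> unfolding straddle_def by (subst nn_integral_add) simp_all
  also have "\<dots> = emeasure \<pi> {p. fst p \<le> a \<and> b < snd p} + emeasure \<pi> {p. snd p \<le> a \<and> b < fst p}"
    by (intro arg_cong2[where f = "(+)"] nn_integral_indicator) measurable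
  finally show ?thesis by (simp add: emeasure_eq_measure)
qed

section \<open>Optimality of the monotone coupling\<close>

lemma prob_space_coupling:
  assumes "real_distribution \<mu>" "\<pi> \<in> couplings \<mu> \<nu>"
  shows "prob_space \<pi>"
proof -
  have [measurable_cong]: "sets \<pi> = sets (borel \<Otimes>\<^sub>M borel)" and 1: "distr \<pi> borel fst = \<mu>"
    using assms by (auto simp: couplings_def)
  \<comment> \<open>\<open>couplings\<close> prescribes no total mass; it is inherited from the
    first marginal.\<close>
  show ?thesis
    using assms(1) unfolding real_distribution_def 1[symmetric]
    by (auto intro: prob_space_distrD[of fst _ borel])
qed

text \<open>A point with first coordinate at most \<open>a\<close> either has second coordinate
  above \<open>b\<close> or lies in the half-plane \<open>snd p \<le> b\<close>. The masses of the
  half-planes are fixed by the marginals.\<close>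

lemma coupling_ge_cdf_diff:
  assumes "real_distribution \<mu>" "\<pi> \<in> couplings \<mu> \<nu>"
  shows "cdf \<mu> a - cdf \<nu> b \<le> measure \<pi> {p. fst p \<le> a \<and> b < snd p}"
    and "cdf \<nu> a - cdf \<mu> b \<le> measure \<pi> {p. snd p \<le> a \<and> b < fst p}"
proof -
  have sets [measurable_cong]: "sets \<pi> = sets (borel \<Otimes>\<^sub>M borel)"
    and "distr \<pi> borel fst = \<mu>" "distr \<pi> borel snd = \<nu>"
    using assms by (auto simp: couplings_def)
  interpret prob_space \<pi> using prob_space_coupling[OF assms] .
  have sp: "space \<pi> = UNIV" using sets_eq_imp_space_eq[OF sets] by (simp add: space_pair_measure)
  have cdf: "cdf \<mu> c = prob {p. fst p \<le> c}" "cdf \<nu> c = prob {p. snd p \<le> c}" for c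
    unfolding \<open>distr \<pi> borel fst = \<mu>\<close>[symmetric] \<open>distr \<pi> borel snd = \<nu>\<close>[symmetric] cdf_def
    by (auto simp: measure_distr sp intro!: arg_cong[where f = prob])
  have diff: "prob A - prob B \<le> prob C" if "A \<subseteq> C \<union> B" "B \<in> events" "C \<in> events" for A B C
    using finite_measure_mono[OF that(1)] measure_Un_le[OF that(3,2)] that by auto
  show "cdf \<mu> a - cdf \<nu> b \<le> measure \<pi> {p. fst p \<le> a \<and> b < snd p}"
    unfolding cdf by (rule diff) (auto simp: sets half_plane_sets)
  show "cdf \<nu> a - cdf \<mu> b \<le> measure \<pi> {p. snd p \<le> a \<and> b < fst p}"
    unfolding cdf by (rule diff) (auto simp: sets half_plane_sets)
qed

text \<open>The law of the pair of quantiles at a common uniform level. The open interval avoids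
  \<open>z = 0\<close>, where the infimum of a measure with support unbounded below is
  meaningless.\<close>

definition monotone_coupling :: "real measure \<Rightarrow> real measure \<Rightarrow> (real \<times> real) measure" where
  "monotone_coupling \<mu> \<nu> = distr (restrict_space lborel {0<..<1}) (borel \<Otimes>\<^sub>M borel)
     (\<lambda>z. (pseudo_inverse \<mu> z, pseudo_inverse \<nu> z))"

lemma (in real_distribution) measurable_pseudo_inverse_unit [measurable]:
  "pseudo_inverse M \<in> borel_measurable (restrict_space lborel {0<..<1})"
  using measurable_pseudo_inverse prob_space
  by (simp add: measurable_def space_restrict_space sets_restrict_space)

lemma monotone_coupling:
  assumes "real_distribution \<mu>" "real_distribution \<nu>"
  shows "monotone_coupling \<mu> \<nu> \<in> couplings \<mu> \<nu>"
proof -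
  interpret \<mu>: real_distribution \<mu> by fact
  interpret \<nu>: real_distribution \<nu> by fact
  show ?thesis
    using \<mu>.distr_pseudo_inverse \<nu>.distr_pseudo_inverse \<mu>.prob_space \<nu>.prob_space
    unfolding couplings_def monotone_coupling_def by (simp add: distr_distr o_def)
qed

lemma monotone_coupling_le_cdf_diff:
  assumes "real_distribution \<mu>" "real_distribution \<nu>"
  shows "measure (monotone_coupling \<mu> \<nu>) {p. fst p \<le> a \<and> b < snd p} \<le> max 0 (cdf \<mu> a - cdf \<nu> b)"
    and "measure (monotone_coupling \<mu> \<nu>) {p. snd p \<le> a \<and> b < fst p} \<le> max 0 (cdf \<nu> a - cdf \<mu> b)"
proof -
  have *: "measure (restrict_space lborel {0<..<1}) {z \<in> {0<..<1}. pseudo_inverse \<rho> z \<le> a \<and> b < pseudo_inverse \<sigma> z}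
      \<le> max 0 (cdf \<rho> a - cdf \<sigma> b)" (is "measure ?R ?S \<le> _")
    if "real_distribution \<rho>" "real_distribution \<sigma>" for \<rho> \<sigma>
  proof -
    interpret \<rho>: real_distribution \<rho> by fact
    interpret \<sigma>: real_distribution \<sigma> by fact
    have S: "?S = {z \<in> space ?R. pseudo_inverse \<rho> z \<le> a \<and> b < pseudo_inverse \<sigma> z}"
      by (simp add: space_restrict_space)
    have "?S \<in> sets ?R" unfolding S by measurable
    then have Sb: "?S \<in> sets lborel" by (subst (asm) sets_restrict_space_iff) simp_all
    \<comment> \<open>At such a level, \<open>z < cdf \<sigma> b\<close> would force the second
      quantile down to at most \<open>b\<close>, and the first quantile being at most
      \<open>a\<close> forces \<open>z \<le> cdf \<rho> a\<close>. The interval may be empty, whence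
      the \<open>max 0\<close>.\<close>
    have sub: "?S \<subseteq> {cdf \<sigma> b..cdf \<rho> a}"
    proof
      fix z assume z: "z \<in> ?S"
      have "cdf \<sigma> b \<le> z" using \<sigma>.pseudo_inverse_le[of z b] z by force
      moreover have "z \<le> cdf \<rho> a"
        using \<rho>.le_cdf_of_pseudo_inverse_le[of z a] \<rho>.prob_space z by auto
      ultimately show "z \<in> {cdf \<sigma> b..cdf \<rho> a}" by simp
    qed
    have "measure ?R ?S = measure lborel ?S" by (subst measure_restrict_space) auto
    also have "\<dots> \<le> measure lborel {cdf \<sigma> b..cdf \<rho> a}"
      by (rule measure_mono_fmeasurable[OF sub Sb]) (simp add: fmeasurable_def emeasure_lborel_Icc_eq)
    also have "\<dots> \<le> max 0 (cdf \<rho> a - cdf \<sigma> b)" by (simp add: measure_def emeasure_lborel_Icc_eq)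
    finally show ?thesis .
  qed
  interpret \<mu>: real_distribution \<mu> by fact
  interpret \<nu>: real_distribution \<nu> by fact
  have "measure (monotone_coupling \<mu> \<nu>) {p. fst p \<le> a \<and> b < snd p}
      = measure (restrict_space lborel {0<..<1}) {z \<in> {0<..<1}. pseudo_inverse \<mu> z \<le> a \<and> b < pseudo_inverse \<nu> z}"
    unfolding monotone_coupling_def
    by (subst measure_distr) (auto simp: vimage_def Int_def space_restrict_space half_plane_sets intro!: arg_cong[where f = "measure _"])
  then show "measure (monotone_coupling \<mu> \<nu>) {p. fst p \<le> a \<and> b < snd p} \<le> max 0 (cdf \<mu> a - cdf \<nu> b)"
    using *[OF assms] by simp
  have "measure (monotone_coupling \<mu> \<nu>) {p. snd p \<le> a \<and> b < fst p}
      = measure (restrict_space lborel {0<..<1}) {z \<in> {0<..<1}. pseudo_inverse \<nu> z \<le> a \<and> b < pseudo_inverse \<mu> z}"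
    unfolding monotone_coupling_def
    by (subst measure_distr) (auto simp: vimage_def Int_def space_restrict_space half_plane_sets intro!: arg_cong[where f = "measure _"])
  then show "measure (monotone_coupling \<mu> \<nu>) {p. snd p \<le> a \<and> b < fst p} \<le> max 0 (cdf \<nu> a - cdf \<mu> b)"
    using *[OF assms(2,1)] by simp
qed

text \<open>For each \<open>a < b\<close> the upper bound for the monotone coupling is the positive
  part of the lower bound valid for every coupling, and masses are nonnegative. So the integrands
  over \<open>(a, b)\<close> are already ordered.\<close>

lemma monotone_coupling_optimal:
  assumes "real_distribution \<mu>" "real_distribution \<nu>" and \<pi>: "\<pi> \<in> couplings \<mu> \<nu>"
  shows "(\<integral>\<^sup>+p. ennreal ((fst p - snd p)\<^sup>2) \<partial>monotone_coupling \<mu> \<nu>)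
     \<le> (\<integral>\<^sup>+p. ennreal ((fst p - snd p)\<^sup>2) \<partial>\<pi>)"
proof -
  let ?\<gamma> = "monotone_coupling \<mu> \<nu>"
  have \<gamma>: "?\<gamma> \<in> couplings \<mu> \<nu>" using monotone_coupling assms by blast
  have sets: "sets \<pi> = sets (borel \<Otimes>\<^sub>M borel)" "sets ?\<gamma> = sets (borel \<Otimes>\<^sub>M borel)"
    using \<pi> \<gamma> by (auto simp: couplings_def)
  have prob: "prob_space \<pi>" "prob_space ?\<gamma>"
    using prob_space_coupling assms(1) \<pi> \<gamma> by blast+
  have "(\<integral>\<^sup>+p. straddle a b p \<partial>?\<gamma>) \<le> (\<integral>\<^sup>+p. straddle a b p \<partial>\<pi>)" for a b
  proof (cases "a < b")
    case True
    from coupling_ge_cdf_diff[OF assms(1) \<pi>, of a b] monotone_coupling_le_cdf_diff[OF assms(1,2), of a b]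
    show ?thesis
      unfolding nn_integral_straddle[OF prob(1) sets(1) True] nn_integral_straddle[OF prob(2) sets(2) True]
      by (intro add_mono ennreal_leI) (auto intro: order_trans)
  next
    case False
    then show ?thesis by (simp add: straddle_def)
  qed
  then show ?thesis
    unfolding transport_cost_eq_straddle[OF prob(1) sets(1)] transport_cost_eq_straddle[OF prob(2) sets(2)]
    by (intro mult_left_mono nn_integral_mono) auto
qed

text \<open>The infimum is attained at the monotone coupling. Should the cost be infinite, both
  sides are 0, as \<open>enn2real\<close> maps infinity to 0 and the Bochner integral of a
  nonintegrable function is 0.\<close>

lemma W2_eq_pseudo_inverse:
  assumes "real_distribution \<mu>" "real_distribution \<nu>"
  shows "W2 \<mu> \<nu> = sqrt (LINT z:{0<..<1}|lborel. (pseudo_inverse \<mu> z - pseudo_inverse \<nu> z)\<^sup>2)"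
proof -
  interpret \<mu>: real_distribution \<mu> by fact
  interpret \<nu>: real_distribution \<nu> by fact
  let ?R = "restrict_space lborel {0<..<(1::real)}"
  have "(INF \<pi> \<in> couplings \<mu> \<nu>. \<integral>\<^sup>+ p. ennreal ((fst p - snd p)\<^sup>2) \<partial>\<pi>)
      = (\<integral>\<^sup>+p. ennreal ((fst p - snd p)\<^sup>2) \<partial>monotone_coupling \<mu> \<nu>)"
    using monotone_coupling_optimal[OF assms] monotone_coupling[OF assms]
    by (intro antisym INF_lower INF_greatest)
  also have "\<dots> = (\<integral>\<^sup>+z. ennreal ((pseudo_inverse \<mu> z - pseudo_inverse \<nu> z)\<^sup>2) \<partial>?R)"
    unfolding monotone_coupling_def by (subst nn_integral_distr) auto
  finally have "W2 \<mu> \<nu> = sqrt (\<integral>z. (pseudo_inverse \<mu> z - pseudo_inverse \<nu> z)\<^sup>2 \<partial>?R)"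
    unfolding W2_def by (subst integral_eq_nn_integral) auto
  then show ?thesis
    by (simp add: set_lebesgue_integral_def integral_restrict_space)
qed

section \<open>Relaxation along a monotone velocity field\<close>

text \<open>The derivative at \<open>a\<close> is one-sided, so the mean value argument uses
  two-sided derivatives at interior points and mere continuity at the endpoint.\<close>

lemma antimono_on_of_nonpos_derivative:
  fixes f f' :: "real \<Rightarrow> real"
  assumes "\<And>t. a \<le> t \<Longrightarrow> (f has_real_derivative f' t) (at t within {a..})"
    and "\<And>t. a \<le> t \<Longrightarrow> f' t \<le> 0"
  shows "antimono_on {a..} f"
proof (intro monotone_onI)
  fix s t :: real assume st: "s \<in> {a..}" "t \<in> {a..}" "s \<le> t"
  show "f t \<le> f s"
  proof (rule DERIV_nonpos_imp_decreasing_open[OF \<open>s \<le> t\<close>])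
    fix u assume "s < u" "u < t"
    then have "a < u" using st by auto
    then have "at u within {a..} = at u"
      by (intro at_within_interior) simp
    then show "\<exists>y. (f has_real_derivative y) (at u) \<and> y \<le> 0"
      using assms[of u] \<open>a < u\<close> by auto
  next
    have "continuous_on {a..} f"
      using assms(1) by (intro DERIV_continuous_on[where D = f']) auto
    then show "continuous_on {s..t} f" by (rule continuous_on_subset) (use st in auto)
  qed
qed

context
  fixes H X :: "real \<Rightarrow> real" and c x :: real
  assumes H: "mono H" "H x = c"
    and X: "\<And>t. 0 \<le> t \<Longrightarrow> (X has_real_derivative c - H (X t)) (at t within {0..})"
begin

lemma relaxation_deriv:
  "0 \<le> t \<Longrightarrow> ((\<lambda>t. (X t - x)\<^sup>2) has_real_derivative 2 * (X t - x) * (c - H (X t))) (at t within {0..})"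
  using X[of t] by (auto intro!: derivative_eq_intros)

text \<open>Quantitative decay outside the \<open>\<epsilon>\<close>-ball: by monotonicity
  \<open>\<bar>H (X t) - c\<bar>\<close> is at least its value at the nearer of
  \<open>x + \<epsilon>\<close> and \<open>x - \<epsilon>\<close>. The minimum covers both sides at
  once.\<close>

lemma relaxation_deriv_le:
  assumes "\<epsilon> > 0" and "\<epsilon> \<le> \<bar>X t - x\<bar>"
  shows "2 * (X t - x) * (c - H (X t)) \<le> - 2 * \<epsilon> * min (H (x + \<epsilon>) - c) (c - H (x - \<epsilon>))"
proof (cases "X t \<ge> x")
  case True
  then have "H (x + \<epsilon>) \<le> H (X t)" using assms H by (intro monoD[OF H(1)]) auto
  moreover have "c \<le> H (x + \<epsilon>)" using assms H monoD[OF H(1), of x "x + \<epsilon>"] by auto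
  ultimately have "\<epsilon> * (H (x + \<epsilon>) - c) \<le> (X t - x) * (H (X t) - c)"
    using True assms by (intro mult_mono) auto
  moreover have "\<epsilon> * min (H (x + \<epsilon>) - c) (c - H (x - \<epsilon>)) \<le> \<epsilon> * (H (x + \<epsilon>) - c)"
    using assms by (intro mult_left_mono) auto
  ultimately show ?thesis by (simp add: algebra_simps)
next
  case False
  then have "H (X t) \<le> H (x - \<epsilon>)" using assms H by (intro monoD[OF H(1)]) auto
  moreover have "H (x - \<epsilon>) \<le> c" using assms H monoD[OF H(1), of "x - \<epsilon>" x] by auto
  ultimately have "\<epsilon> * (c - H (x - \<epsilon>)) \<le> (x - X t) * (c - H (X t))"
    using False assms by (intro mult_mono) auto
  moreover have "\<epsilon> * min (H (x + \<epsilon>) - c) (c - H (x - \<epsilon>)) \<le> \<epsilon> * (c - H (x - \<epsilon>))"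
    using assms by (intro mult_left_mono) auto
  ultimately show ?thesis by (simp add: algebra_simps)
qed

lemma relaxation_antimono: "antimono_on {0..} (\<lambda>t. (X t - x)\<^sup>2)"
proof (rule antimono_on_of_nonpos_derivative[OF relaxation_deriv])
  fix t
  show "2 * (X t - x) * (c - H (X t)) \<le> 0"
    using monoD[OF H(1), of x "X t"] monoD[OF H(1), of "X t" x] H(2)
    by (cases "x \<le> X t") (auto simp: mult_le_0_iff)
qed simp_all

text \<open>Uniqueness makes the decay rate outside each ball strictly positive, so the trajectory
  enters the ball in finite time; by \<open>relaxation_antimono\<close> it never leaves
  again.\<close>

lemma relaxation_tendsto:
  assumes unique: "\<And>y. H y = c \<Longrightarrow> y = x"
  shows "(X \<longlongrightarrow> x) at_top"
proof (rule tendstoI)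
  fix \<epsilon> :: real assume "\<epsilon> > 0"
  define \<delta> where "\<delta> = 2 * \<epsilon> * min (H (x + \<epsilon>) - c) (c - H (x - \<epsilon>))"
  have "H (x + \<epsilon>) \<noteq> c" "H (x - \<epsilon>) \<noteq> c" using unique[of "x + \<epsilon>"] unique[of "x - \<epsilon>"] \<open>\<epsilon> > 0\<close> by auto
  moreover have "c \<le> H (x + \<epsilon>)" "H (x - \<epsilon>) \<le> c"
    using \<open>\<epsilon> > 0\<close> H monoD[OF H(1), of x "x + \<epsilon>"] monoD[OF H(1), of "x - \<epsilon>" x] by auto
  ultimately have "\<delta> > 0" using \<open>\<epsilon> > 0\<close> by (simp add: \<delta>_def)
  have "\<exists>T\<ge>0. \<bar>X T - x\<bar> < \<epsilon>"
  proof (rule ccontr)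
    assume "\<not> ?thesis"
    then have far: "\<epsilon> \<le> \<bar>X t - x\<bar>" if "0 \<le> t" for t using that by force
    \<comment> \<open>Adding \<open>\<delta> * t\<close> offsets the decay rate
      \<open>\<delta>\<close>, so the rate bound becomes plain monotonicity.\<close>
    have "antimono_on {0..} (\<lambda>t. (X t - x)\<^sup>2 + \<delta> * t)"
    proof (rule antimono_on_of_nonpos_derivative)
      fix t :: real assume "0 \<le> t"
      then show "((\<lambda>t. (X t - x)\<^sup>2 + \<delta> * t) has_real_derivative
          2 * (X t - x) * (c - H (X t)) + \<delta>) (at t within {0..})"
        by (intro DERIV_add relaxation_deriv DERIV_cmult_Id)
      show "2 * (X t - x) * (c - H (X t)) + \<delta> \<le> 0"
        using relaxation_deriv_le[OF \<open>\<epsilon> > 0\<close> far[OF \<open>0 \<le> t\<close>]] by (simp add: \<delta>_def)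
    qed
    then have le: "(X t - x)\<^sup>2 + \<delta> * t \<le> (X 0 - x)\<^sup>2" if "0 \<le> t" for t
      using that by (auto dest: monotone_onD[where x = 0 and y = t])
    \<comment> \<open>At this time \<open>\<delta> * ?t\<close> exceeds the initial squared distance
      by 1, so the remaining square would have to be negative.\<close>
    let ?t = "((X 0 - x)\<^sup>2 + 1) / \<delta>"
    have "(X ?t - x)\<^sup>2 + \<delta> * ?t \<le> (X 0 - x)\<^sup>2" using \<open>\<delta> > 0\<close> by (intro le) simp
    moreover have "\<delta> * ?t = (X 0 - x)\<^sup>2 + 1" using \<open>\<delta> > 0\<close> by simp
    ultimately show False using zero_le_power2[of "X ?t - x"] by linarith
  qed
  then obtain T where T: "T \<ge> 0" "\<bar>X T - x\<bar> < \<epsilon>" by blast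
  have "dist (X t) x < \<epsilon>" if "t \<ge> T" for t
  proof -
    have "(X t - x)\<^sup>2 \<le> (X T - x)\<^sup>2"
      using monotone_onD[OF relaxation_antimono, of T t] T that by auto
    then have "\<bar>X t - x\<bar> \<le> \<bar>X T - x\<bar>" by (simp add: abs_le_square_iff)
    then show ?thesis using T by (simp add: dist_real_def)
  qed
  then show "\<forall>\<^sub>F t in at_top. dist (X t) x < \<epsilon>"
    by (auto simp: eventually_at_top_linorder)
qed

end

section \<open>The equilibrium of a monotone velocity field\<close>

text \<open>This yields uniqueness of the steady state. If the two sides differed, some
  \<open>z\<close> would lie strictly between them, and inside the unit interval because both sides
  do; applying \<open>H\<close> to the comparison of \<open>x\<close> with the quantile at
  \<open>z\<close> contradicts \<open>inv\<close>.\<close>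

lemma cdf_eq_of_pseudo_inverse:
  assumes "real_distribution \<nu>" and H: "mono H"
    and inv: "\<And>z. z \<in> {0<..<1} \<Longrightarrow> H (pseudo_inverse \<nu> z) = 2 * z - 1"
  shows "cdf \<nu> x = min 1 (max 0 ((H x + 1) / 2))" (is "?p = min 1 (max 0 ?u)")
proof -
  interpret real_distribution \<nu> by fact
  have p: "0 \<le> ?p" "?p \<le> 1" using cdf_nonneg cdf_bounded_prob by auto
  have below: "z \<le> ?u" if "z \<in> {0<..<1}" "z < ?p" for z
    using monoD[OF H pseudo_inverse_le[of z x]] inv[of z] that by auto
  have above: "?u \<le> z" if "z \<in> {0<..<1}" "?p \<le> z" for z
    using monoD[OF H le_pseudo_inverse[of z x]] inv[of z] that prob_space by auto
  show ?thesis
  proof (cases ?p "min 1 (max 0 ?u)" rule: linorder_cases)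
    case less
    then obtain z where "?p < z" "z < min 1 (max 0 ?u)" using dense by blast
    then show ?thesis using above[of z] p by (auto simp: max_def split: if_splits)
  next
    case greater
    then obtain z where "min 1 (max 0 ?u) < z" "z < ?p" using dense by blast
    then show ?thesis using below[of z] p by (auto simp: min_def max_def split: if_splits)
  qed
qed

text \<open>Isolates what convergence needs to know about the kernel. That \<open>H\<close> attains
  -1 and 1 keeps the superlevel sets in question nonempty and bounded below.\<close>

locale equilibrium = real_distribution M for M :: "real measure" +
  fixes H :: "real \<Rightarrow> real" and xl xr :: real
  assumes mono_H: "mono H" and cont_H: "continuous_on UNIV H"
    and H_xl: "H xl = -1" and H_xr: "H xr = 1"
    and cdf_eq: "cdf M x = min 1 (max 0 ((H x + 1) / 2))"
begin

text \<open>The quantile is the left end of a superlevel set of \<open>H\<close>, and a continuous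
  function takes exactly the level there. The value \<open>z = 0\<close> is included, as the steady
  state equation demands it.\<close>

lemma pseudo_inverse_bounds:
  assumes "z \<in> {0..<1}"
  shows "pseudo_inverse M z \<in> {xl..xr}" and "H (pseudo_inverse M z) = 2 * z - 1"
proof -
  \<comment> \<open>For \<open>z\<close> in \<open>{0..<1}\<close> the truncation to the unit
    interval does not alter the superlevel set, so the cdf may be replaced by
    \<open>H\<close>.\<close>
  let ?S = "{x. 2 * z - 1 < H x}"
  have eq: "pseudo_inverse M z = Inf ?S"
    unfolding pseudo_inverse_def
    by (rule arg_cong[where f = Inf]) (use assms in \<open>auto simp: cdf_eq min_def max_def field_simps\<close>)
  have lower: "xl \<le> x" if "x \<in> ?S" for x
    using monoD[OF mono_H, of x xl] that assms H_xl by force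
  then have bdd: "bdd_below ?S" by (intro bdd_belowI)
  have xr: "xr \<in> ?S" using H_xr assms by simp
  have ge: "xl \<le> Inf ?S" using lower xr by (intro cInf_greatest) auto
  moreover have "Inf ?S \<le> xr" using xr bdd by (rule cInf_lower)
  ultimately show "pseudo_inverse M z \<in> {xl..xr}" by (simp add: eq)
  have "Inf ?S \<in> closure ?S" using xr bdd by (intro closure_contains_Inf) auto
  also have "closure ?S \<subseteq> {x. 2 * z - 1 \<le> H x}"
    by (intro closure_minimal closed_Collect_le cont_H continuous_intros) auto
  finally have "2 * z - 1 \<le> H (Inf ?S)" by simp
  moreover have "H (Inf ?S) \<le> 2 * z - 1"
  proof (rule ccontr)
    assume less: "\<not> ?thesis"
    \<comment> \<open>A value halfway between the level and \<open>H (Inf ?S)\<close> is attained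
      strictly to the left of the infimum, at a point which nevertheless belongs to
      \<open>?S\<close>.\<close>
    then have "\<exists>x\<ge>xl. x \<le> Inf ?S \<and> H x = (H (Inf ?S) + (2 * z - 1)) / 2"
      using assms ge H_xl by (intro IVT' continuous_on_subset[OF cont_H]) auto
    then obtain x where x: "x \<le> Inf ?S" "H x = (H (Inf ?S) + (2 * z - 1)) / 2" by blast
    with less have "x \<in> ?S" by (simp add: field_simps)
    then have "x = Inf ?S" using x bdd by (intro antisym cInf_lower)
    with x less show False by simp
  qed
  ultimately show "H (pseudo_inverse M z) = 2 * z - 1" by (simp add: eq)
qed

text \<open>A level set of \<open>H\<close> with more than one point is a jump of the pseudo-inverse, and there are
  only countably many of these.\<close>

lemma AE_level_unique:
  "AE z in lborel. z \<in> {0<..<1} \<longrightarrow> (\<forall>y. H y = 2 * z - 1 \<longrightarrow> y = pseudo_inverse M z)"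
proof -
  have "mono_on {0<..<1} (pseudo_inverse M)"
    using mono_on_pseudo_inverse prob_space by simp
  then have "countable {z \<in> {0<..<1}. \<not> isCont (pseudo_inverse M) z}"
    by (intro mono_on_ctble_discont_open) auto
  then have "AE z in lborel. z \<notin> {z \<in> {0<..<1}. \<not> isCont (pseudo_inverse M) z}"
    by (intro AE_not_in) (rule countable_imp_null_set_lborel)
  then show ?thesis
  proof (rule AE_mp, intro AE_I2 impI allI)
    fix z y assume z: "z \<notin> {z \<in> {0<..<1}. \<not> isCont (pseudo_inverse M) z}" "z \<in> {0<..<1}"
      and y: "H y = 2 * z - 1"
    have cdf_y: "cdf M y = z" using z y by (simp add: cdf_eq)
    \<comment> \<open>For \<open>w < z = cdf M y\<close> the quantile at \<open>w\<close> is at most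
      \<open>y\<close>; continuity at \<open>z\<close> carries this bound to the left limit.\<close>
    have "(pseudo_inverse M \<longlongrightarrow> pseudo_inverse M z) (at_left z)"
      using z by (auto simp: isCont_def intro: tendsto_within_subset)
    moreover have "\<forall>\<^sub>F w in at_left z. pseudo_inverse M w \<le> y"
      using eventually_at_left_real[of 0 z] z
      by (auto elim!: eventually_mono intro: pseudo_inverse_le simp: cdf_y)
    ultimately have "pseudo_inverse M z \<le> y"
      by (rule tendsto_upperbound) simp
    moreover have "y \<le> pseudo_inverse M z"
      using z prob_space by (intro le_pseudo_inverse) (auto simp: cdf_y)
    ultimately show "y = pseudo_inverse M z" by simp
  qed
qed

section \<open>Convergence of the flow to the equilibrium\<close>

context
  fixes \<mu> :: "real \<Rightarrow> real measure"
  assumes distr: "\<And>t. 0 \<le> t \<Longrightarrow> real_distribution (\<mu> t)"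
    and bdd: "bounded (pseudo_inverse (\<mu> 0) ` {0<..<1})"
    and flow: "\<And>t z. 0 \<le> t \<Longrightarrow> z \<in> {0<..<1} \<Longrightarrow>
      ((\<lambda>s. pseudo_inverse (\<mu> s) z) has_real_derivative 2 * z - 1 - H (pseudo_inverse (\<mu> t) z))
        (at t within {0..})"
begin

abbreviation "sqdist t z \<equiv> (pseudo_inverse (\<mu> t) z - pseudo_inverse M z)\<^sup>2"

lemma sqdist_antimono:
  assumes "z \<in> {0<..<1}"
  shows "antimono_on {0..} (\<lambda>t. sqdist t z)"
proof (rule relaxation_antimono[OF mono_H])
  show "H (pseudo_inverse M z) = 2 * z - 1" using assms by (intro pseudo_inverse_bounds(2)) simp
qed (use assms in \<open>blast intro: flow\<close>)

lemma sqdist_tendsto: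
  "AE z in restrict_space lborel {0<..<1}. ((\<lambda>t. sqdist t z) \<longlongrightarrow> 0) at_top"
proof -
  have "AE z in lborel. z \<in> {0<..<1} \<longrightarrow> ((\<lambda>t. sqdist t z) \<longlongrightarrow> 0) at_top"
    using AE_level_unique
  proof (rule AE_mp, intro AE_I2 impI)
    fix z :: real assume unique: "z \<in> {0<..<1} \<longrightarrow> (\<forall>y. H y = 2 * z - 1 \<longrightarrow> y = pseudo_inverse M z)"
      and z: "z \<in> {0<..<1}"
    have "((\<lambda>t. pseudo_inverse (\<mu> t) z) \<longlongrightarrow> pseudo_inverse M z) at_top"
    proof (rule relaxation_tendsto[OF mono_H])
      show "H (pseudo_inverse M z) = 2 * z - 1" using z by (intro pseudo_inverse_bounds(2)) simp
    qed (use unique z in \<open>blast intro: flow\<close>)+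
    from tendsto_power[OF tendsto_diff[OF this tendsto_const[of "pseudo_inverse M z"]], of 2]
    show "((\<lambda>t. sqdist t z) \<longlongrightarrow> 0) at_top" by simp
  qed
  then show ?thesis by (subst AE_restrict_space_iff) auto
qed

text \<open>The dominating constant: a bound at time 0 persists because each
  \<open>sqdist t z\<close> decreases in \<open>t\<close>.\<close>

lemma sqdist_bounded:
  obtains B where "\<And>t z. 0 \<le> t \<Longrightarrow> z \<in> {0<..<1} \<Longrightarrow> sqdist t z \<le> B"
proof -
  obtain C where C: "\<And>z. z \<in> {0<..<1} \<Longrightarrow> \<bar>pseudo_inverse (\<mu> 0) z\<bar> \<le> C"
    using bdd unfolding bounded_iff by (metis imageI real_norm_def)
  show thesis
  proof
    fix t z :: real assume t: "0 \<le> t" and z: "z \<in> {0<..<1}"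
    have "\<bar>pseudo_inverse (\<mu> 0) z - pseudo_inverse M z\<bar> \<le> C + (\<bar>xl\<bar> + \<bar>xr\<bar>)"
      using C[OF z] pseudo_inverse_bounds(1)[of z] z by auto
    then have "sqdist 0 z \<le> (C + (\<bar>xl\<bar> + \<bar>xr\<bar>))\<^sup>2"
      by (simp add: abs_le_square_iff[symmetric])
    then show "sqdist t z \<le> (C + (\<bar>xl\<bar> + \<bar>xr\<bar>))\<^sup>2"
      using monotone_onD[OF sqdist_antimono[OF z], of 0 t] t by auto
  qed
qed

lemma measurable_sqdist:
  "0 \<le> t \<Longrightarrow> sqdist t \<in> borel_measurable (restrict_space lborel {0<..<1})"
  using real_distribution.measurable_pseudo_inverse_unit[OF distr] measurable_pseudo_inverse_unit
  by measurable

lemma W2_eq_sqdist: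
  "0 \<le> t \<Longrightarrow> W2 (\<mu> t) M = sqrt (integral\<^sup>L (restrict_space lborel {0<..<1}) (sqdist t))"
  using W2_eq_pseudo_inverse[OF distr real_distribution_axioms, of t]
  by (simp add: set_lebesgue_integral_def integral_restrict_space)

lemma finite_measure_unit: "finite_measure (restrict_space lborel {0<..<1::real})"
  by (rule finite_measureI) (simp add: emeasure_restrict_space space_restrict_space)

lemma integrable_sqdist: "0 \<le> t \<Longrightarrow> integrable (restrict_space lborel {0<..<1}) (sqdist t)"
proof -
  assume t: "0 \<le> t"
  obtain B where "\<And>t z. 0 \<le> t \<Longrightarrow> z \<in> {0<..<1} \<Longrightarrow> sqdist t z \<le> B" using sqdist_bounded by blast
  then show ?thesis using t measurable_sqdist
    by (intro finite_measure.integrable_const_bound[OF finite_measure_unit, where B = B] AE_I2)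
      (auto simp: space_restrict_space)
qed

lemma W2_antimono: "antimono_on {0..} (\<lambda>t. W2 (\<mu> t) M)"
proof (intro monotone_onI)
  fix s t :: real assume st: "s \<in> {0..}" "t \<in> {0..}" "s \<le> t"
  have "integral\<^sup>L (restrict_space lborel {0<..<1}) (sqdist t)
      \<le> integral\<^sup>L (restrict_space lborel {0<..<1}) (sqdist s)"
    using st
    by (intro integral_mono integrable_sqdist)
      (auto simp: space_restrict_space intro: monotone_onD[OF sqdist_antimono])
  then show "W2 (\<mu> t) M \<le> W2 (\<mu> s) M" using st by (simp add: W2_eq_sqdist)
qed

lemma W2_tendsto: "((\<lambda>t. W2 (\<mu> t) M) \<longlongrightarrow> 0) at_top"
proof -
  let ?R = "restrict_space lborel {0<..<1::real}"
  interpret R: finite_measure ?R by (rule finite_measure_unit)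
  obtain B where B: "\<And>t z. 0 \<le> t \<Longrightarrow> z \<in> {0<..<1} \<Longrightarrow> sqdist t z \<le> B" using sqdist_bounded by blast
  \<comment> \<open>Dominated convergence asks for measurability at every real \<open>t\<close>,
    while the curve is controlled for \<open>t \<ge> 0\<close> only; hence
    \<open>max 0 t\<close>.\<close>
  have "((\<lambda>t. integral\<^sup>L ?R (sqdist (max 0 t))) \<longlongrightarrow> integral\<^sup>L ?R (\<lambda>z. 0)) at_top"
  proof (rule integral_dominated_convergence_at_top[where w = "\<lambda>z. B"])
    show "AE z in ?R. ((\<lambda>t. sqdist (max 0 t) z) \<longlongrightarrow> 0) at_top"
      using sqdist_tendsto
    proof (rule AE_mp, intro AE_I2 impI)
      fix z assume "((\<lambda>t. sqdist t z) \<longlongrightarrow> 0) at_top"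
      then show "((\<lambda>t. sqdist (max 0 t) z) \<longlongrightarrow> 0) at_top"
        by (rule Lim_transform_eventually) (auto intro: eventually_mono[OF eventually_ge_at_top[of 0]])
    qed
    show "\<forall>\<^sub>F t in at_top. AE z in ?R. norm (sqdist (max 0 t) z) \<le> B"
      using B by (intro always_eventually allI AE_I2) (auto simp: space_restrict_space)
  qed (auto intro: measurable_sqdist)
  then have "((\<lambda>t. sqrt (integral\<^sup>L ?R (sqdist (max 0 t)))) \<longlongrightarrow> 0) at_top"
    using tendsto_real_sqrt by fastforce
  then show ?thesis
    by (rule Lim_transform_eventually)
      (auto simp: W2_eq_sqdist intro: eventually_mono[OF eventually_ge_at_top[of 0]])
qed

end

end

section \<open>The kernels\<close>

lemma dpsi_eq:
  assumes "1 \<le> q"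
  shows "dpsi q x = q * sgn x * \<bar>x\<bar> powr (q - 1)"
proof (cases "q = 1")
  case True
  then show ?thesis by (simp add: dpsi_def sgn_if)
next
  case False
  have "(psi q has_real_derivative q * sgn x * \<bar>x\<bar> powr (q - 1)) (at x)"
  proof (cases x "0 :: real" rule: linorder_cases)
    case less
    have "((\<lambda>x. (- x) powr q) has_real_derivative q * sgn x * \<bar>x\<bar> powr (q - 1)) (at x)"
      using less by (auto intro!: derivative_eq_intros)
    then show ?thesis
      by (rule has_field_derivative_transform_within_open[where S = "{..<0}"])
        (use less in \<open>auto simp: psi_def\<close>)
  next
    case greater
    have "((\<lambda>x. x powr q) has_real_derivative q * sgn x * \<bar>x\<bar> powr (q - 1)) (at x)"
      using greater by (auto intro!: derivative_eq_intros)
    then show ?thesis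
      by (rule has_field_derivative_transform_within_open[where S = "{0<..}"])
        (use greater in \<open>auto simp: psi_def\<close>)
  next
    case equal
    \<comment> \<open>At 0 the difference quotient has modulus
      \<open>\<bar>h\<bar> powr (q - 1)\<close>, which vanishes in the limit because
      \<open>q > 1\<close>.\<close>
    have "((\<lambda>h::real. \<bar>h\<bar> powr (q - 1)) \<longlongrightarrow> 0) (at 0)"
      using False assms by (auto intro!: tendsto_eq_intros)
    moreover have "\<bar>h\<bar> powr (q - 1) = norm (\<bar>h\<bar> powr q / h)" if "h \<noteq> 0" for h :: real
      using that by (simp add: powr_diff abs_mult)
    ultimately have "((\<lambda>h::real. norm (\<bar>h\<bar> powr q / h)) \<longlongrightarrow> 0) (at 0)"
      by (elim Lim_transform_eventually) (auto simp: eventually_at_filter)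
    then have "((\<lambda>h::real. \<bar>h\<bar> powr q / h) \<longlongrightarrow> 0) (at 0)"
      by (rule tendsto_norm_zero_cancel)
    then show ?thesis by (simp add: DERIV_def psi_def equal)
  qed
  then show ?thesis using False by (simp add: dpsi_def DERIV_imp_deriv)
qed

lemma mono_dpsi:
  assumes "1 \<le> q"
  shows "mono (dpsi q)"
proof (rule monoI)
  fix x y :: real assume "x \<le> y"
  have pos: "0 \<le> q * \<bar>u\<bar> powr (q - 1)" for u using assms by simp
  consider "0 < x" | "y < 0" | "x \<le> 0" "0 \<le> y" by linarith
  then show "dpsi q x \<le> dpsi q y"
  proof cases
    case 1
    then show ?thesis using \<open>x \<le> y\<close> assms
      by (auto simp: dpsi_eq intro!: mult_left_mono powr_mono2)
  next
    case 2
    then show ?thesis using \<open>x \<le> y\<close> assms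
      by (auto simp: dpsi_eq intro!: mult_left_mono powr_mono2)
  next
    case 3
    then have "dpsi q x \<le> 0" "0 \<le> dpsi q y"
      using assms pos[of x] pos[of y] by (auto simp: dpsi_eq sgn_if)
    then show ?thesis by simp
  qed
qed

lemma measurable_dpsi [measurable]: "1 \<le> q \<Longrightarrow> dpsi q \<in> borel_measurable borel"
  by (rule borel_measurable_mono[OF mono_dpsi])

lemma continuous_dpsi:
  assumes "1 < q"
  shows "continuous_on UNIV (dpsi q)"
proof -
  have "isCont (dpsi q) x" for x
  proof (cases "x = 0")
    case True
    have "((\<lambda>h::real. q * \<bar>h\<bar> powr (q - 1)) \<longlongrightarrow> 0) (at 0)"
      using assms by (auto intro!: tendsto_eq_intros)
    moreover have "q * \<bar>h\<bar> powr (q - 1) = norm (dpsi q h)" if "h \<noteq> 0" for h :: real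
      using that assms by (simp add: dpsi_eq abs_mult)
    ultimately have "((\<lambda>h::real. norm (dpsi q h)) \<longlongrightarrow> 0) (at 0)"
      by (elim Lim_transform_eventually) (auto simp: eventually_at_filter)
    then have "(dpsi q \<longlongrightarrow> 0) (at 0)" by (rule tendsto_norm_zero_cancel)
    then show ?thesis using True assms by (simp add: isCont_def dpsi_eq)
  next
    case False
    have "isCont (\<lambda>x. q * sgn x * \<bar>x\<bar> powr (q - 1)) x"
      using False by (intro continuous_intros) auto
    moreover have "dpsi q = (\<lambda>x. q * sgn x * \<bar>x\<bar> powr (q - 1))"
      using assms by (intro ext dpsi_eq) simp
    ultimately show ?thesis by simp
  qed
  then show ?thesis by (simp add: continuous_at_imp_continuous_on)
qed

lemma dpsi_has_derivative:
  assumes "1 < q" "x \<noteq> 0"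
  shows "(dpsi q has_real_derivative ddpsi q x) (at x)"
proof (cases "x < 0")
  case True
  have "((\<lambda>x. - (q * (- x) powr (q - 1))) has_real_derivative ddpsi q x) (at x)"
    using True by (auto intro!: derivative_eq_intros simp: ddpsi_def)
  then show ?thesis
    by (rule has_field_derivative_transform_within_open[where S = "{..<0}"])
      (use True assms in \<open>auto simp: dpsi_eq\<close>)
next
  case False
  then have "((\<lambda>x. q * x powr (q - 1)) has_real_derivative ddpsi q x) (at x)"
    using assms by (auto intro!: derivative_eq_intros simp: ddpsi_def)
  then show ?thesis
    by (rule has_field_derivative_transform_within_open[where S = "{0<..}"])
      (use False assms in \<open>auto simp: dpsi_eq\<close>)
qed

lemma measurable_ddpsi [measurable]: "ddpsi q \<in> borel_measurable borel"
  unfolding ddpsi_def[abs_def] by measurable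

lemma ddpsi_nonneg: "1 \<le> q \<Longrightarrow> 0 \<le> ddpsi q x"
  by (simp add: ddpsi_def)

lemma ddpsi_minus [simp]: "ddpsi q (- x) = ddpsi q x"
  by (simp add: ddpsi_def)

text \<open>For \<open>q < 2\<close> the integrand blows up at \<open>x = y\<close>. The fundamental
  theorem still applies with \<open>y\<close> as exceptional point, since \<open>dpsi q\<close> is
  continuous there.\<close>

lemma nn_integral_ddpsi:
  assumes "1 < q" "a \<le> b"
  shows "(\<integral>\<^sup>+x. indicator {a..b} x * ennreal (ddpsi q (x - y)) \<partial>lborel) = ennreal (dpsi q (b - y) - dpsi q (a - y))"
proof -
  have "((\<lambda>x. ddpsi q (x - y)) has_integral dpsi q (b - y) - dpsi q (a - y)) {a..b}"
  proof (rule fundamental_theorem_of_calculus_strong[where S = "{y}"])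
    fix x assume "x \<in> {a..b} - {y}"
    then have "((\<lambda>x. dpsi q (x - y)) has_real_derivative ddpsi q (x - y)) (at x)"
      using DERIV_shift[of "dpsi q" "ddpsi q (x - y)" x "- y"] dpsi_has_derivative[OF assms(1), of "x - y"] by simp
    then show "((\<lambda>x. dpsi q (x - y)) has_vector_derivative ddpsi q (x - y)) (at x)"
      by (simp add: has_real_derivative_iff_has_vector_derivative)
  next
    show "continuous_on {a..b} (\<lambda>x. dpsi q (x - y))"
      by (rule continuous_on_compose2[OF continuous_dpsi[OF assms(1)]]) (auto intro: continuous_intros)
  qed (use assms in auto)
  then have "(\<integral>\<^sup>+x. ennreal (indicator {a..b} x * ddpsi q (x - y)) \<partial>lborel)
      = ennreal (dpsi q (b - y) - dpsi q (a - y))"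
    using assms by (intro nn_integral_has_integral_lebesgue) (auto simp: ddpsi_nonneg)
  moreover have "ennreal (indicator {a..b} x * ddpsi q (x - y)) = indicator {a..b} x * ennreal (ddpsi q (x - y))" for x
    by (simp add: indicator_def)
  ultimately show ?thesis by simp
qed

section \<open>Measures with bounded compactly supported density\<close>

lemma has_Linf_c_densityI:
  assumes [measurable]: "h \<in> borel_measurable borel" and "\<And>x. 0 \<le> h x" "\<And>x. h x \<le> B"
    and "\<And>x. x \<notin> {a..b} \<Longrightarrow> h x = 0"
  shows "has_Linf_c_density (density lborel (\<lambda>x. ennreal (h x)))"
  using assms unfolding has_Linf_c_density_def Linf_c_def
  by (intro bexI[of _ h]) (auto intro!: exI[of _ B] exI[of _ "{a..b}"])

text \<open>Fixes a representative of the density that obeys its bounds everywhere instead of almost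
  everywhere.\<close>

locale compact_density =
  fixes g :: "real \<Rightarrow> real" and C L :: real and \<omega> :: "real measure"
  assumes g_meas [measurable]: "g \<in> borel_measurable borel"
    and g_nonneg: "\<And>x. 0 \<le> g x" and g_le: "\<And>x. g x \<le> C"
    and g_outside: "\<And>x. L < \<bar>x\<bar> \<Longrightarrow> g x = 0"
    and \<omega>_def: "\<omega> = density lborel (\<lambda>x. ennreal (g x))"

lemma has_Linf_c_density_imp_compact_density:
  assumes "has_Linf_c_density \<omega>"
  obtains g C L where "compact_density g C L \<omega>"
proof -
  obtain f C K where f [measurable]: "f \<in> borel_measurable borel"
    and fC: "AE x in lborel. \<bar>f x\<bar> \<le> C" and K: "compact K" and fK: "AE x in lborel. x \<notin> K \<longrightarrow> f x = 0"
    and f0: "AE x in lborel. 0 \<le> f x" and \<omega>: "\<omega> = density lborel (\<lambda>x. ennreal (f x))"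
    using assms by (auto simp: has_Linf_c_density_def Linf_c_def)
  obtain L where L: "\<And>x. x \<in> K \<Longrightarrow> \<bar>x\<bar> \<le> L"
    using compact_imp_bounded[OF K] unfolding bounded_iff by auto
  define g where "g x = (if 0 \<le> f x \<and> f x \<le> C \<and> \<bar>x\<bar> \<le> L then f x else 0)" for x
  have [measurable]: "g \<in> borel_measurable borel" unfolding g_def[abs_def] by measurable
  have "compact_density g \<bar>C\<bar> L \<omega>"
  proof
    show "\<omega> = density lborel (\<lambda>x. ennreal (g x))"
      unfolding \<omega>
    proof (rule density_cong)
      show "AE x in lborel. ennreal (f x) = ennreal (g x)"
        using fC fK f0
      proof eventually_elim
        case (elim x)
        then show ?case using L[of x] by (auto simp: g_def)
      qed
    qed measurable
  qed (auto simp: g_def)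
  then show thesis by (rule that)
qed

context compact_density
begin

lemma sets_\<omega> [simp, measurable_cong]: "sets \<omega> = sets borel"
  by (simp add: \<omega>_def)

lemma space_\<omega> [simp]: "space \<omega> = UNIV"
  by (simp add: \<omega>_def)

lemma finite_measure_\<omega>: "finite_measure \<omega>"
proof (rule finite_measureI)
  have "emeasure \<omega> (space \<omega>) = (\<integral>\<^sup>+x. ennreal (g x) \<partial>lborel)"
    by (simp add: \<omega>_def emeasure_density)
  also have "\<dots> \<le> (\<integral>\<^sup>+x. ennreal C * indicator {-L..L} x \<partial>lborel)"
    using g_le g_outside
    by (intro nn_integral_mono) (auto simp: indicator_def ennreal_leI abs_le_iff)
  also have "\<dots> = ennreal C * emeasure lborel {-L..L}"
    by (simp add: nn_integral_cmult)
  also have "\<dots> < \<infinity>"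
    by (simp add: emeasure_lborel_Icc_eq ennreal_mult_less_top)
  finally show "emeasure \<omega> (space \<omega>) \<noteq> \<infinity>" by simp
qed

sublocale finite_borel_measure \<omega>
  by (intro finite_borel_measure.intro finite_measure_\<omega>) (simp add: finite_borel_measure_axioms_def)

lemma AE_support: "AE y in \<omega>. \<bar>y\<bar> \<le> L"
  using g_outside unfolding \<omega>_def by (subst AE_density) (auto intro!: AE_I2 intro: leI)

lemma AE_neq: "AE y in \<omega>. y \<noteq> x"
  unfolding \<omega>_def by (subst AE_density) (auto intro: AE_mp[OF AE_lborel_singleton])

lemma nn_integral_\<omega>:
  "f \<in> borel_measurable borel \<Longrightarrow> (\<integral>\<^sup>+y. f y \<partial>\<omega>) = (\<integral>\<^sup>+y. ennreal (g y) * f y \<partial>lborel)"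
  by (simp add: \<omega>_def nn_integral_density)

context
  fixes q :: real
  assumes q: "1 \<le> q" "q \<le> 2"
begin

abbreviation "H \<equiv> conv_with (dpsi q) \<omega>"

lemma measurable_dpsi_q [measurable]: "dpsi q \<in> borel_measurable borel"
  using q by measurable

text \<open>On the support \<open>\<bar>y\<bar> \<le> L\<close>, so the monotone
  \<open>dpsi q\<close> is bounded by its values at the two extreme arguments.\<close>

lemma integrable_dpsi: "integrable \<omega> (\<lambda>y. dpsi q (x - y))"
proof (rule integrable_const_bound)
  show "AE y in \<omega>. norm (dpsi q (x - y)) \<le> max \<bar>dpsi q (x - L)\<bar> \<bar>dpsi q (x + L)\<bar>"
    using AE_support
  proof eventually_elim
    case (elim y)
    then have "dpsi q (x - L) \<le> dpsi q (x - y)" "dpsi q (x - y) \<le> dpsi q (x + L)"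
      using q by (auto intro!: monoD[OF mono_dpsi])
    then show ?case by simp
  qed
qed measurable

lemma mono_conv_dpsi: "mono H"
  unfolding conv_with_def
  using q by (intro monoI integral_mono integrable_dpsi) (auto intro!: monoD[OF mono_dpsi])

lemma attraction_eq_conv: "attraction q \<omega> X z = H (X z)"
proof (cases "q = 1")
  case True
  have "H (X z) = (\<integral>y. 2 * indicator {..X z} y - 1 \<partial>\<omega>)"
    unfolding conv_with_def
  proof (rule integral_cong_AE)
    \<comment> \<open>The two functions differ only at \<open>y = X z\<close>, where
      \<open>sgn\<close> is 0; this point carries no mass.\<close>
    show "AE y in \<omega>. dpsi q (X z - y) = 2 * indicator {..X z} y - 1"
      using AE_neq[of "X z"]
      by eventually_elim (auto simp: True dpsi_def sgn_if indicator_def)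
  qed measurable
  also have "\<dots> = 2 * cdf \<omega> (X z) - measure \<omega> UNIV"
    by (subst Bochner_Integration.integral_diff)
      (auto simp: cdf_def less_top[symmetric] intro!: integrable_real_indicator)
  finally show ?thesis using True by (simp add: attraction_def)
next
  case False
  let ?m = "measure \<omega> UNIV" and ?Y = "pseudo_inverse \<omega>"
  let ?R = "restrict_space lborel {0<..<?m}"
  have [measurable]: "?Y \<in> borel_measurable ?R"
    using measurable_pseudo_inverse
    by (simp add: measurable_def space_restrict_space sets_restrict_space)
  have "attraction q \<omega> X z = (LINT \<zeta>:{0..<?m}|lborel. dpsi q (X z - ?Y \<zeta>))"
    using False by (simp add: attraction_def)
  \<comment> \<open>Discarding the null set \<open>{0}\<close> gives the open interval on which
    \<open>distr_pseudo_inverse\<close> is stated.\<close>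
  also have "\<dots> = (LINT \<zeta>:{0<..<?m}|lborel. dpsi q (X z - ?Y \<zeta>))"
    unfolding set_lebesgue_integral_def
    by (rule integral_discrete_difference[of "{0}"]) (auto simp: indicator_def)
  also have "\<dots> = (\<integral>\<zeta>. dpsi q (X z - ?Y \<zeta>) \<partial>?R)"
    by (simp add: set_lebesgue_integral_def integral_restrict_space)
  also have "\<dots> = (\<integral>y. dpsi q (X z - y) \<partial>distr ?R borel ?Y)"
    by (subst integral_distr) measurable
  also have "\<dots> = H (X z)"
    by (simp add: distr_pseudo_inverse conv_with_def)
  finally show ?thesis .
qed

text \<open>Within distance 1 of \<open>x\<close> the density is at most \<open>C\<close> and the
  singular kernel has integral \<open>2 * q\<close>. Farther away the kernel is at most
  \<open>q * (q - 1)\<close>, because its exponent \<open>q - 2\<close> is not positive.\<close>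

lemma nn_integral_conv_ddpsi_le:
  assumes "1 < q"
  shows "(\<integral>\<^sup>+y. ennreal (ddpsi q (x - y)) \<partial>\<omega>) \<le> ennreal (2 * q * C + q * (q - 1) * measure \<omega> UNIV)"
proof -
  have C: "0 \<le> C" using g_nonneg g_le order_trans by blast
  have "(\<integral>\<^sup>+y. ennreal (ddpsi q (x - y)) \<partial>\<omega>) = (\<integral>\<^sup>+y. ennreal (g y) * ennreal (ddpsi q (x - y)) \<partial>lborel)"
    by (rule nn_integral_\<omega>) measurable
  also have "\<dots> \<le> (\<integral>\<^sup>+y. ennreal C * (indicator {x-1..x+1} y * ennreal (ddpsi q (y - x)))
      + ennreal (q * (q - 1)) * ennreal (g y) \<partial>lborel)"
  proof (rule nn_integral_mono)
    fix y
    have sym: "ddpsi q (x - y) = ddpsi q (y - x)" using ddpsi_minus[of q "x - y"] by simp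
    show "ennreal (g y) * ennreal (ddpsi q (x - y)) \<le> ennreal C * (indicator {x-1..x+1} y * ennreal (ddpsi q (y - x)))
      + ennreal (q * (q - 1)) * ennreal (g y)"
    proof (cases "y \<in> {x-1..x+1}")
      case True
      have "ennreal (g y) * ennreal (ddpsi q (x - y)) \<le> ennreal C * ennreal (ddpsi q (y - x))"
        unfolding sym by (intro mult_right_mono ennreal_leI g_le) simp
      then show ?thesis using True by (simp add: add_increasing2)
    next
      case False
      then have "\<bar>x - y\<bar> powr (q - 2) \<le> \<bar>x - y\<bar> powr 0"
        using q by (intro powr_mono) auto
      also have "\<dots> \<le> 1" by simp
      finally have "ddpsi q (x - y) \<le> q * (q - 1)"
        unfolding ddpsi_def using assms by (intro mult_left_le) auto
      then have "ennreal (g y) * ennreal (ddpsi q (x - y)) \<le> ennreal (g y) * ennreal (q * (q - 1))"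
        by (intro mult_left_mono ennreal_leI) auto
      then show ?thesis using False by (simp add: mult.commute)
    qed
  qed
  also have "\<dots> = ennreal C * (\<integral>\<^sup>+y. indicator {x-1..x+1} y * ennreal (ddpsi q (y - x)) \<partial>lborel)
      + ennreal (q * (q - 1)) * (\<integral>\<^sup>+y. ennreal (g y) \<partial>lborel)"
    by (subst nn_integral_add) (auto simp: nn_integral_cmult)
  also have "(\<integral>\<^sup>+y. indicator {x-1..x+1} y * ennreal (ddpsi q (y - x)) \<partial>lborel) = ennreal (2 * q)"
    using assms by (subst nn_integral_ddpsi) (auto simp: dpsi_eq)
  also have "(\<integral>\<^sup>+y. ennreal (g y) \<partial>lborel) = ennreal (measure \<omega> UNIV)"
    unfolding emeasure_eq_measure[symmetric] by (simp add: \<omega>_def emeasure_density)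
  also have "ennreal C * ennreal (2 * q) + ennreal (q * (q - 1)) * ennreal (measure \<omega> UNIV)
      = ennreal (2 * q * C + q * (q - 1) * measure \<omega> UNIV)"
    using C assms by (simp add: ennreal_mult'[symmetric] ennreal_plus[symmetric] mult.commute del: ennreal_plus)
  finally show ?thesis .
qed

definition half_density :: "real \<Rightarrow> real" where
  "half_density x = (if q = 1 then g x else 1/2 * conv_with (ddpsi q) \<omega> x)"

text \<open>The sum of the bounds for \<open>q = 1\<close> and \<open>q > 1\<close>, so that a
  single constant serves both cases.\<close>

definition half_bound :: real where
  "half_bound = C + (2 * q * C + q * (q - 1) * measure \<omega> UNIV)"

lemma measurable_half_density [measurable]: "half_density \<in> borel_measurable borel"
  unfolding half_density_def[abs_def] conv_with_def by measurable

lemma half_density_nonneg: "0 \<le> half_density x"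
  using q g_nonneg by (auto simp: half_density_def conv_with_def ddpsi_nonneg intro!: integral_nonneg)

lemma half_ddpsi_conv_eq: "half_ddpsi_conv q \<omega> = density lborel (\<lambda>x. ennreal (half_density x))"
  by (simp add: half_ddpsi_conv_def half_density_def[abs_def]) (simp add: \<omega>_def)

lemma integrable_ddpsi:
  assumes "1 < q"
  shows "integrable \<omega> (\<lambda>y. ddpsi q (x - y))"
  using nn_integral_conv_ddpsi_le[OF assms, of x] assms
  by (intro integrableI_nonneg AE_I2) (auto simp: ddpsi_nonneg top_unique less_top[symmetric])

lemma ennreal_conv_ddpsi:
  assumes "1 < q"
  shows "ennreal (conv_with (ddpsi q) \<omega> x) = (\<integral>\<^sup>+y. ennreal (ddpsi q (x - y)) \<partial>\<omega>)"
  unfolding conv_with_def using assms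
  by (intro nn_integral_eq_integral[symmetric] integrable_ddpsi) (auto simp: ddpsi_nonneg)

lemma half_bound_nonneg: "0 \<le> half_bound"
  using q g_nonneg[of 0] g_le[of 0] by (auto simp: half_bound_def)

lemma half_density_le: "half_density x \<le> half_bound"
proof -
  have C: "0 \<le> C" using g_nonneg g_le order_trans by blast
  have rest: "0 \<le> 2 * q * C + q * (q - 1) * measure \<omega> UNIV" using C q by simp
  show ?thesis
  proof (cases "q = 1")
    case True
    then show ?thesis unfolding half_density_def half_bound_def using g_le[of x] C by simp
  next
    case False
    then have "1 < q" using q by simp
    from nn_integral_conv_ddpsi_le[OF this, of x]
    have "conv_with (ddpsi q) \<omega> x \<le> 2 * q * C + q * (q - 1) * measure \<omega> UNIV"
      unfolding ennreal_conv_ddpsi[OF \<open>1 < q\<close>, symmetric] using rest by (simp add: ennreal_le_iff)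
    then show ?thesis using False C rest by (simp add: half_density_def half_bound_def)
  qed
qed

text \<open>Integrated form of the statement that \<open>half_density\<close> is half the derivative
  of \<open>H\<close>. It gives both the Lipschitz bound for \<open>H\<close> and the cdf of the
  candidate steady state.\<close>

lemma nn_integral_half_density:
  assumes "a \<le> b"
  shows "(\<integral>\<^sup>+x. indicator {a..b} x * ennreal (half_density x) \<partial>lborel) = ennreal ((H b - H a) / 2)"
proof (cases "q = 1")
  case True
  have H: "H x = 2 * cdf \<omega> x - measure \<omega> UNIV" for x
    using attraction_eq_conv[of "\<lambda>_. x" 0] True by (simp add: attraction_def)
  have "(\<integral>\<^sup>+x. indicator {a..b} x * ennreal (half_density x) \<partial>lborel) = emeasure \<omega> {a..b}"
    unfolding half_density_def using True by (simp add: \<omega>_def emeasure_density mult.commute)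
  \<comment> \<open>The endpoint \<open>a\<close> has no mass, and \<open>emeasure_Ioc\<close>
    expects a half-open interval.\<close>
  also have "\<dots> = emeasure \<omega> {a<..b}"
    using AE_neq[of a] by (intro emeasure_eq_AE) (auto elim!: eventually_mono)
  also have "\<dots> = ennreal (cdf \<omega> b - cdf \<omega> a)" using assms by (rule emeasure_Ioc)
  also have "cdf \<omega> b - cdf \<omega> a = (H b - H a) / 2" by (simp add: H field_simps)
  finally show ?thesis .
next
  case False
  then have q1: "1 < q" using q by simp
  interpret P: pair_sigma_finite lborel \<omega> ..
  have half: "indicator {a..b} x * ennreal (half_density x)
      = (\<integral>\<^sup>+y. ennreal (1/2) * (indicator {a..b} x * ennreal (ddpsi q (x - y))) \<partial>\<omega>)" for x
  proof -
    have "ennreal (half_density x) = ennreal (1/2) * ennreal (conv_with (ddpsi q) \<omega> x)"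
      unfolding half_density_def using False by (subst ennreal_mult'[symmetric]) auto
    moreover have "(\<integral>\<^sup>+y. ennreal (1/2) * (indicator {a..b} x * ennreal (ddpsi q (x - y))) \<partial>\<omega>)
        = ennreal (1/2) * (indicator {a..b} x * (\<integral>\<^sup>+y. ennreal (ddpsi q (x - y)) \<partial>\<omega>))"
      by (subst nn_integral_cmult, measurable)+
    ultimately show ?thesis
      by (simp only: ennreal_conv_ddpsi[OF q1] mult.left_commute)
  qed
  have "(\<integral>\<^sup>+x. indicator {a..b} x * ennreal (half_density x) \<partial>lborel)
      = (\<integral>\<^sup>+y. \<integral>\<^sup>+x. ennreal (1/2) * (indicator {a..b} x * ennreal (ddpsi q (x - y))) \<partial>lborel \<partial>\<omega>)"
    unfolding half by (rule P.Fubini'[symmetric]) measurable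
  also have "\<dots> = (\<integral>\<^sup>+y. ennreal (1/2) * ennreal (dpsi q (b - y) - dpsi q (a - y)) \<partial>\<omega>)"
    using nn_integral_ddpsi[OF q1 assms] by (simp add: nn_integral_cmult)
  also have "\<dots> = (\<integral>\<^sup>+y. ennreal (1/2 * (dpsi q (b - y) - dpsi q (a - y))) \<partial>\<omega>)"
    by (subst ennreal_mult'[symmetric]) auto
  also have "\<dots> = ennreal (\<integral>y. 1/2 * (dpsi q (b - y) - dpsi q (a - y)) \<partial>\<omega>)"
    using assms q
    by (intro nn_integral_eq_integral integrable_mult_right Bochner_Integration.integrable_diff
        integrable_dpsi AE_I2) (auto intro!: monoD[OF mono_dpsi])
  also have "(\<integral>y. 1/2 * (dpsi q (b - y) - dpsi q (a - y)) \<partial>\<omega>) = (H b - H a) / 2"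
    by (simp add: conv_with_def integrable_dpsi)
  finally show ?thesis .
qed

text \<open>The bound on \<open>half_density\<close> makes \<open>H\<close> Lipschitz with constant
  \<open>2 * half_bound\<close>, also for \<open>q = 1\<close>, where the kernel itself
  jumps.\<close>

lemma continuous_conv_dpsi: "continuous_on UNIV H"
proof -
  have diff: "H b - H a \<le> 2 * half_bound * (b - a)" if "a \<le> b" for a b
  proof -
    have "ennreal ((H b - H a) / 2) \<le> (\<integral>\<^sup>+x. ennreal half_bound * indicator {a..b} x \<partial>lborel)"
      unfolding nn_integral_half_density[OF that, symmetric]
      by (intro nn_integral_mono) (auto simp: indicator_def half_density_le ennreal_leI)
    also have "\<dots> = ennreal (half_bound * (b - a))"
      using that half_bound_nonneg by (simp add: nn_integral_cmult ennreal_mult')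
    finally have "(H b - H a) / 2 \<le> half_bound * (b - a)"
      using that half_bound_nonneg by (simp add: ennreal_le_iff)
    then show ?thesis by simp
  qed
  have "(2 * half_bound)-lipschitz_on UNIV H"
  proof (rule lipschitz_onI)
    fix x y :: real
    show "dist (H x) (H y) \<le> 2 * half_bound * dist x y"
      using diff[of x y] diff[of y x] monoD[OF mono_conv_dpsi, of x y] monoD[OF mono_conv_dpsi, of y x]
      by (cases "x \<le> y") (auto simp: dist_real_def abs_if)
  qed (use half_bound_nonneg in simp)
  then show ?thesis by (rule lipschitz_on_continuous_on)
qed

section \<open>The explicit steady state\<close>

context
  fixes xl xr :: real
  assumes x: "xl < xr" "H xl = -1" "H xr = 1"
begin

abbreviation "\<mu>s \<equiv> density (half_ddpsi_conv q \<omega>) (indicator {xl..xr})"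

lemma \<mu>s_eq: "\<mu>s = density lborel (\<lambda>x. ennreal (half_density x * indicator {xl..xr} x))"
  unfolding half_ddpsi_conv_eq
  by (subst density_density_eq) (auto intro!: density_cong simp: indicator_def)

lemma Linf_c_density_\<mu>s: "has_Linf_c_density \<mu>s"
  unfolding \<mu>s_eq
  by (rule has_Linf_c_densityI[where B = half_bound and a = xl and b = xr])
    (auto simp: half_density_nonneg half_density_le half_bound_nonneg indicator_def)

text \<open>Integrating from \<open>xl\<close>, where \<open>H\<close> is -1, gives
  \<open>(H y + 1) / 2\<close> up to \<open>xr\<close>. Outside the interval monotonicity puts
  \<open>H\<close> at most -1 or at least 1, which is what the truncation records.\<close>

lemma emeasure_\<mu>s_atMost:
  "emeasure \<mu>s {..y} = ennreal (min 1 (max 0 ((H y + 1) / 2)))"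
proof (cases "xl \<le> y")
  case True
  have "emeasure \<mu>s {..y} = (\<integral>\<^sup>+x. indicator {xl..min y xr} x * ennreal (half_density x) \<partial>lborel)"
    unfolding \<mu>s_eq
    by (subst emeasure_density) (auto intro!: nn_integral_cong simp: indicator_def)
  also have "\<dots> = ennreal ((H (min y xr) + 1) / 2)"
    using x True by (subst nn_integral_half_density) auto
  also have "(H (min y xr) + 1) / 2 = min 1 (max 0 ((H y + 1) / 2))"
    using x True monoD[OF mono_conv_dpsi, of y xr] monoD[OF mono_conv_dpsi, of xr y]
      monoD[OF mono_conv_dpsi, of xl y]
    by (auto simp: min_def max_def)
  finally show ?thesis .
next
  case False
  have "ennreal (half_density x * indicator {xl..xr} x) * indicator {..y} x = 0" for x
    using False by (simp add: indicator_def)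
  then have "emeasure \<mu>s {..y} = 0"
    unfolding \<mu>s_eq by (subst emeasure_density) (simp_all only: nn_integral_const, simp_all)
  moreover have "H y \<le> -1" using x False monoD[OF mono_conv_dpsi, of y xl] by simp
  ultimately show ?thesis by (simp add: max_def)
qed

lemma real_distribution_\<mu>s: "real_distribution \<mu>s"
proof -
  have "emeasure \<mu>s UNIV = emeasure \<mu>s {..xr}"
    unfolding \<mu>s_eq
    by (simp add: emeasure_density) (auto intro!: nn_integral_cong simp: indicator_def)
  also have "\<dots> = 1" using x by (simp add: emeasure_\<mu>s_atMost)
  finally have "prob_space \<mu>s" by (intro prob_spaceI) (simp add: half_ddpsi_conv_eq)
  then show ?thesis
    by (simp add: real_distribution_def real_distribution_axioms_def half_ddpsi_conv_eq)
qed

lemma equilibrium_\<mu>s: "equilibrium \<mu>s H xl xr"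
  using real_distribution_\<mu>s mono_conv_dpsi continuous_conv_dpsi x
  by (auto simp: equilibrium_def equilibrium_axioms_def cdf_def measure_def emeasure_\<mu>s_atMost)

text \<open>Forward, the equation fixes the cdf on the whole line through
  \<open>cdf_eq_of_pseudo_inverse\<close>, and the cdf fixes the measure. Backward,
  \<open>pseudo_inverse_bounds\<close> is the equation itself.\<close>

lemma steady_state_iff: "steady_state q 1 \<omega> \<nu> \<longleftrightarrow> \<nu> = \<mu>s"
proof
  assume \<nu>: "steady_state q 1 \<omega> \<nu>"
  interpret equilibrium \<mu>s H xl xr by (rule equilibrium_\<mu>s)
  have "cdf \<nu> = cdf \<mu>s"
  proof
    fix y
    have "cdf \<nu> y = min 1 (max 0 ((H y + 1) / 2))"
      using \<nu> by (intro cdf_eq_of_pseudo_inverse mono_conv_dpsi)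
        (auto simp: steady_state_def attraction_eq_conv repulsion_def)
    then show "cdf \<nu> y = cdf \<mu>s y" by (simp add: cdf_eq)
  qed
  then show "\<nu> = \<mu>s"
    using \<nu> real_distribution_\<mu>s by (intro cdf_unique) (auto simp: steady_state_def)
next
  assume "\<nu> = \<mu>s"
  then show "steady_state q 1 \<omega> \<nu>"
    using equilibrium.pseudo_inverse_bounds(2)[OF equilibrium_\<mu>s] real_distribution_\<mu>s Linf_c_density_\<mu>s
    by (auto simp: steady_state_def attraction_eq_conv repulsion_def)
qed

end

end

end

theorem theorem4p4:
  fixes qa qr m xl xr :: real
    and \<omega> \<mu>s :: "real measure"
    and \<mu> :: "real \<Rightarrow> real measure"
  assumes "qa \<in> {1..2}" and "qr \<in> {1..2}"
    and "has_Linf_c_density \<omega>"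
    and "m = measure \<omega> UNIV" and "m > 0"
    and "(2 \<ge> qa \<and> qa > qr \<and> qr = 1) \<or> (qa = 1 \<and> qr = 1 \<and> m \<ge> 1)"
    and "xl < xr"
    and "conv_with (dpsi qa) \<omega> xl = -1" and "conv_with (dpsi qa) \<omega> xr = 1"
    and "\<mu>s = density (half_ddpsi_conv qa \<omega>) (indicator {xl..xr})"
    and "transient_solution qa qr \<omega> \<mu>"
  shows "(\<forall>\<nu>. steady_state qa qr \<omega> \<nu> \<longleftrightarrow> \<nu> = \<mu>s) \<and>
    antimono_on {0..} (\<lambda>t. W2 (\<mu> t) \<mu>s) \<and>
    ((\<lambda>t. W2 (\<mu> t) \<mu>s) \<longlongrightarrow> 0) at_top"
proof -
  have qr: "qr = 1" and qa: "1 \<le> qa" "qa \<le> 2" using assms by auto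
  obtain g C L where "compact_density g C L \<omega>"
    using has_Linf_c_density_imp_compact_density[OF assms(3)] .
  then interpret compact_density g C L \<omega> .
  have steady: "steady_state qa 1 \<omega> \<nu> \<longleftrightarrow> \<nu> = \<mu>s" for \<nu>
    using steady_state_iff[OF qa assms(7,8,9)] assms(10) by simp
  interpret E: equilibrium \<mu>s "conv_with (dpsi qa) \<omega>" xl xr
    using equilibrium_\<mu>s[OF qa assms(7,8,9)] assms(10) by simp
  have distr: "real_distribution (\<mu> t)" if "0 \<le> t" for t
    using assms(11) that by (auto simp: transient_solution_def P2_def)
  \<comment> \<open>Boundedness at time 0 comes from membership in the cadlag space and feeds the
    dominating constant.\<close>
  have "bounded (pseudo_inverse (\<mu> 0) ` {0..<1})"
    using assms(11) by (auto simp: transient_solution_def C1_cadlag_def cadlag_on_def)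
  then have bdd: "bounded (pseudo_inverse (\<mu> 0) ` {0<..<1})"
    by (rule bounded_subset) auto
  have flow: "((\<lambda>s. pseudo_inverse (\<mu> s) z) has_real_derivative
      2 * z - 1 - conv_with (dpsi qa) \<omega> (pseudo_inverse (\<mu> t) z)) (at t within {0..})"
    if "0 \<le> t" "z \<in> {0<..<1}" for t z
  proof -
    have "((\<lambda>s. pseudo_inverse (\<mu> s) z) has_real_derivative
        - attraction qa \<omega> (pseudo_inverse (\<mu> t)) z + repulsion qr (pseudo_inverse (\<mu> t)) z)
        (at t within {0..})"
      using assms(11) that by (auto simp: transient_solution_def)
    then show ?thesis
      by (simp add: attraction_eq_conv[OF qa] repulsion_def qr algebra_simps)
  qed
  show ?thesis
    using E.W2_antimono[OF distr bdd flow] E.W2_tendsto[OF distr bdd flow] steady qr by simp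
qed

end
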